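(* Let $m,\ell\ge 1$ with $\ell\mid 2m$, put $n=2m/\ell$, and let $r$ be an admissible integer for $n$ (see context). Let $G=G(\mathcal D_m,\mathcal C_\ell,\psi_r)$ be the standard copy, and suppose that $[\![u,v]\!]\ne[\![e_1,e_2]\!]$ is a system of imprimitivity for $G$. Then $v$ is orthogonal to $u$, $\ell$ is $1$ or $2$, and the possible representatives for $u$ (that is, for a spanning vector of one of the two subspaces of the system) are $(1,1)$, $(1,ai)$, $(1,j)$ and $(1,ck)$ for some non-zero $a,c\in\mathbb R$. Moreover: (i) $[\![(1,1),(1,-1)]\!]$ is a system of imprimitivity for $G$ if and only if $r=1$. (ii) If $[\![(1,ai),(ai,1)]\!]$ is a system of imprimitivity for $G$ for some non-zero $a\in\mathbb R$, then $r=1$. Suppose $r=1$ and $a\in\mathbb R$. If $\ell=1$, then $[\![(1,ai),(ai,1)]\!]$ is a system of imprimitivity for $G$ for all $m$; if $\ell=2$, it is a system of imprimitivity for $G$ if and only if $a\in\{-1,0,1\}$. (iii) If $\ell=1$, then $[\![(1,j),(j,1)]\!]$ is a system of imprimitivity for $G$ if and only if either $m\equiv 2\pmod 4$ and $r=m-1$, or $m=r=1$. If $\ell=2$, it is a system of imprimitivity for $G$ if and only if $m\in\{1,2\}$ and $r=1$. (iv) $[\![(1,ck),(ck,1)]\!]$ is a system of imprimitivity for $G$ for all $c\in\mathbb R$ if and only if $m=\ell=1$. Otherwise, if $\ell=1$ and $m\ge 2$, $[\![(1,k),(k,1)]\!]$ is a system of imprimitivity for $G$ if and only if $m\equiv 2\pmod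 4$ and $r=m-1$. If $\ell=2$, $[\![(1,k),(k,1)]\!]$ is a system of imprimitivity for $G$ if and only if $m\in\{1,2\}$ and $r=1$.
   Context: $\mathbb H$ is the real quaternion algebra with units $i,j,k$, and $\mathbb S^3$ is the group of quaternions of norm $1$. $V=\mathbb H^2$ is the left $\mathbb H$-space of row vectors with $(u\mid v)=u_1\overline{v_1}+u_2\overline{v_2}$; matrices act by right multiplication; $\mathrm U_2(\mathbb H)$ is the group of $2\times2$ quaternionic matrices $A$ with $A\overline A^{\top}=I$. $e_1=(1,0)$, $e_2=(0,1)$. For a finite subgroup $K$ of $\mathbb S^3$, $H\trianglelefteq K$ and $\varphi\in\mathrm{Aut}(K/H)$ with $\varphi^2=1$, $G(K,H,\varphi)\subset \mathrm U_2(\mathbb H)$ is the group of order $2|K||H|$ consisting of all matrices $\mathrm{diag}(\xi,\eta)$ with $\xi,\eta\in K$, $\varphi(H\xi)=H\eta$, together with their products with $\begin{pmatrix}0&1\\1&0\end{pmatrix}$. A system of imprimitivity for $G\subset\mathrm U_2(\mathbb H)$ is a set $\{V_1,V_2\}$ of non-zero subspaces of $V$ with $V=V_1\oplus V_2$ which are permuted among themselves by $G$; $[\![u,v]\!]$ denotes $\{\mathbb Hu,\mathbb Hv\}$. Let $\zeta_q=\cos(2\pi/q)+i\sin(2\pi/q)$, $\mathcal C_q=\langle\zeta_q\rangle$, $\mathcal D_m=\langle \zeta_{2m},j\rangle$ (order $4m$). For $n\ell=2m$, the standard copy of $G(\mathcal D_m,\mathcal C_\ell,\psi_r)$ is the group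 $G(K,H,\psi_r)$ with $x=\zeta_{2m}$, $y=j$, $K=\langle x,y\rangle=\mathcal D_m$, $H=\langle x^n\rangle=\mathcal C_\ell$ and $\psi_r$ the automorphism of $K/H$ with $\psi_r(Hx)=Hx^r$, $\psi_r(Hy)=Hy^{-1}$. An integer $r$ is admissible for $n$ if $r=1$, or $1<r\le n/2$ and $\gcd(r,n)=\gcd(\kappa,\nu)=1$, where $\kappa=n/\gcd(n,r+1)$ and $\nu=n/\gcd(n,r-1)$.
   Formalization: For m=1 the list of representatives for u is enlarged by (1, ai+ck) with a, c both non-zero, since the stated list is incomplete there (for m=ℓ=1, [[(1,i+k),(i+k,1)]] is a system of imprimitivity); for m≥2 the list is as stated. *)

theory Defs
  imports "HOL-Analysis.Analysis" "HOL-Algebra.Generated_Groups" "HOL-Algebra.Coset"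
begin

section \<open>The real quaternion algebra\<close>

datatype quat = Quat (re: real) (im1: real) (im2: real) (im3: real)

lemma quat_eq_iff: "p = q \<longleftrightarrow> re p = re q \<and> im1 p = im1 q \<and> im2 p = im2 q \<and> im3 p = im3 q"
  by (cases p; cases q) simp

definition qcnj :: "quat \<Rightarrow> quat" where
  "qcnj q = Quat (re q) (- im1 q) (- im2 q) (- im3 q)"

definition qnorm :: "quat \<Rightarrow> real" where
  "qnorm q = sqrt ((re q)\<^sup>2 + (im1 q)\<^sup>2 + (im2 q)\<^sup>2 + (im3 q)\<^sup>2)"

instantiation quat :: real_div_algebra
begin

definition "0 = Quat 0 0 0 0"
definition "1 = Quat 1 0 0 0"
definition "p + q = Quat (re p + re q) (im1 p + im1 q) (im2 p + im2 q) (im3 p + im3 q)"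
definition "- q = Quat (- re q) (- im1 q) (- im2 q) (- im3 q)"
definition "p - q = Quat (re p - re q) (im1 p - im1 q) (im2 p - im2 q) (im3 p - im3 q)"
definition "a *\<^sub>R q = Quat (a * re q) (a * im1 q) (a * im2 q) (a * im3 q)" for q :: quat

definition
  "p * q = Quat
     (re p * re q - im1 p * im1 q - im2 p * im2 q - im3 p * im3 q)
     (re p * im1 q + im1 p * re q + im2 p * im3 q - im3 p * im2 q)
     (re p * im2 q - im1 p * im3 q + im2 p * re q + im3 p * im1 q)
     (re p * im3 q + im1 p * im2 q - im2 p * im1 q + im3 p * re q)"

definition "inverse q = (1 / (qnorm q)\<^sup>2) *\<^sub>R qcnj q"
definition "p div q = p * inverse q" for p q :: quat

lemmas quat_ops_def = zero_quat_def one_quat_def plus_quat_def uminus_quat_def minus_quat_def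
  scaleR_quat_def times_quat_def

lemma qnorm_square: "(qnorm q)\<^sup>2 = (re q)\<^sup>2 + (im1 q)\<^sup>2 + (im2 q)\<^sup>2 + (im3 q)\<^sup>2"
  by (simp add: qnorm_def)

lemma qnorm_square_eq_0: "(qnorm q)\<^sup>2 = 0 \<longleftrightarrow> q = 0"
  unfolding qnorm_square
  by (simp add: quat_eq_iff zero_quat_def sum_power2_eq_zero_iff add_nonneg_eq_0_iff)

lemma quat_mult_qcnj: "q * qcnj q = (qnorm q)\<^sup>2 *\<^sub>R 1" "qcnj q * q = (qnorm q)\<^sup>2 *\<^sub>R 1"
  unfolding qnorm_square
  by (simp_all add: quat_eq_iff quat_ops_def qcnj_def power2_eq_square)

instance
proof
  fix p q r :: quat and a b :: real
  show "p + q + r = p + (q + r)" "p + q = q + p" "0 + p = p" "- p + p = 0" "p - q = p + - q"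
    "p * q * r = p * (q * r)" "1 * p = p" "p * 1 = p" "(p + q) * r = p * r + q * r"
    "p * (q + r) = p * q + p * r" "(0::quat) \<noteq> 1" "a *\<^sub>R (p + q) = a *\<^sub>R p + a *\<^sub>R q"
    "(a + b) *\<^sub>R p = a *\<^sub>R p + b *\<^sub>R p" "a *\<^sub>R b *\<^sub>R p = (a * b) *\<^sub>R p" "1 *\<^sub>R p = p"
    "a *\<^sub>R p * q = a *\<^sub>R (p * q)" "p * a *\<^sub>R q = a *\<^sub>R (p * q)"
    by (simp_all add: quat_eq_iff quat_ops_def algebra_simps)
  have scale: "c *\<^sub>R s * t = c *\<^sub>R (s * t)" "s * c *\<^sub>R t = c *\<^sub>R (s * t)"
    "c *\<^sub>R d *\<^sub>R s = (c * d) *\<^sub>R s" "1 *\<^sub>R s = s" for c d :: real and s t :: quat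
    by (simp_all add: quat_eq_iff quat_ops_def algebra_simps)
  show "inverse p * p = 1" "p * inverse p = 1" if "p \<noteq> 0"
    using that qnorm_square_eq_0[of p]
    by (simp_all add: inverse_quat_def scale quat_mult_qcnj)
  show "p div q = p * inverse q" by (rule divide_quat_def)
  show "inverse (0::quat) = 0"
    by (simp add: quat_eq_iff inverse_quat_def quat_ops_def qcnj_def)
qed

end

definition qi :: quat where "qi = Quat 0 1 0 0"
definition qj :: quat where "qj = Quat 0 0 1 0"
definition qk :: quat where "qk = Quat 0 0 0 1"

lemma quat_units:
  "qi * qi = -1" "qj * qj = -1" "qk * qk = -1"
  "qi * qj = qk" "qj * qk = qi" "qk * qi = qj"
  "qj * qi = - qk" "qk * qj = - qi" "qi * qk = - qj"
  by (simp_all add: quat_eq_iff quat_ops_def qi_def qj_def qk_def)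

section \<open>Finite subgroups of the group of unit quaternions\<close>

definition S3 :: "quat monoid" where
  "S3 = \<lparr>carrier = {q. qnorm q = 1}, mult = (*), one = 1\<rparr>"

lemma qnorm_mult: "qnorm (p * q) = qnorm p * qnorm q"
proof -
  have "(qnorm (p * q))\<^sup>2 = (qnorm p * qnorm q)\<^sup>2"
    unfolding power_mult_distrib qnorm_square by (simp add: times_quat_def power2_eq_square algebra_simps)
  then show ?thesis
    by (simp add: power2_eq_iff_nonneg qnorm_def)
qed

lemma group_S3: "group S3"
proof (rule groupI)
  fix q assume "q \<in> carrier S3"
  then have "qcnj q \<in> carrier S3" "qcnj q \<otimes>\<^bsub>S3\<^esub> q = \<one>\<^bsub>S3\<^esub>"
    by (simp_all add: S3_def quat_mult_qcnj) (simp add: qnorm_def qcnj_def)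
  then show "\<exists>p\<in>carrier S3. p \<otimes>\<^bsub>S3\<^esub> q = \<one>\<^bsub>S3\<^esub>"
    by blast
qed (auto simp: S3_def qnorm_mult mult.assoc, simp add: qnorm_def one_quat_def)

definition zeta :: "nat \<Rightarrow> quat" where
  "zeta q = cos (2 * pi / real q) *\<^sub>R 1 + sin (2 * pi / real q) *\<^sub>R qi"

definition Cgrp :: "nat \<Rightarrow> quat set" where
  "Cgrp q = generate S3 {zeta q}"

definition Dgrp :: "nat \<Rightarrow> quat set" where
  "Dgrp m = generate S3 {zeta (2 * m), qj}"

section \<open>The left space of row vectors and its systems of imprimitivity\<close>

text \<open>
  The library's \<^const>\<open>vector_scalar_mult\<close> multiplies scalars on the left of the entries and
  \<^const>\<open>vector_matrix_mult\<close> multiplies matrix entries on the right of the vector entries, so over a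
  noncommutative ring they are exactly the left action of scalars and the right action of matrices
  on row vectors.
\<close>

definition hform :: "quat ^ 2 \<Rightarrow> quat ^ 2 \<Rightarrow> quat" where
  "hform u v = u $ 1 * qcnj (v $ 1) + u $ 2 * qcnj (v $ 2)"

definition left_subspace :: "(quat ^ 2) set \<Rightarrow> bool" where
  "left_subspace W \<longleftrightarrow>
     0 \<in> W \<and> (\<forall>u\<in>W. \<forall>v\<in>W. u + v \<in> W) \<and> (\<forall>q. \<forall>u\<in>W. q *s u \<in> W)"

definition left_line :: "quat ^ 2 \<Rightarrow> (quat ^ 2) set" where
  "left_line u = {q *s u | q. True}"

definition line_pair :: "quat ^ 2 \<Rightarrow> quat ^ 2 \<Rightarrow> (quat ^ 2) set set" where
  "line_pair u v = {left_line u, left_line v}"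

definition imprimitivity_system :: "(quat ^ 2 ^ 2) set \<Rightarrow> (quat ^ 2) set set \<Rightarrow> bool" where
  "imprimitivity_system G S \<longleftrightarrow>
     (\<exists>V1 V2. S = {V1, V2} \<and> left_subspace V1 \<and> left_subspace V2 \<and> V1 \<noteq> {0} \<and> V2 \<noteq> {0} \<and>
        V1 \<inter> V2 = {0} \<and> (\<forall>w. \<exists>v1\<in>V1. \<exists>v2\<in>V2. w = v1 + v2)) \<and>
     (\<forall>A\<in>G. (\<lambda>W. (\<lambda>w. w v* A) ` W) ` S = S)"

section \<open>The groups \<open>G(K, H, \<phi>)\<close> and the standard copies\<close>

definition diag2 :: "quat \<Rightarrow> quat \<Rightarrow> quat ^ 2 ^ 2" where
  "diag2 p q = vector [vector [p, 0], vector [0, q]]"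

definition swap2 :: "quat ^ 2 ^ 2" where
  "swap2 = vector [vector [0, 1], vector [1, 0]]"

definition G_group :: "quat set \<Rightarrow> quat set \<Rightarrow> (quat set \<Rightarrow> quat set) \<Rightarrow> (quat ^ 2 ^ 2) set" where
  "G_group K H \<phi> =
     (let \<Delta> = {diag2 \<xi> \<eta> | \<xi> \<eta>. \<xi> \<in> K \<and> \<eta> \<in> K \<and> \<phi> (H #>\<^bsub>S3\<^esub> \<xi>) = H #>\<^bsub>S3\<^esub> \<eta>}
      in \<Delta> \<union> (\<lambda>A. A ** swap2) ` \<Delta>)"

definition admissible :: "nat \<Rightarrow> nat \<Rightarrow> bool" where
  "admissible n r \<longleftrightarrow>
     r = 1 \<or>
     1 < r \<and> real r \<le> real n / 2 \<and> gcd r n = 1 \<and>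
       gcd (n div gcd n (r + 1)) (n div gcd n (r - 1)) = 1"

text \<open>
  \<open>is_psi m l r \<phi>\<close> says that \<open>\<phi>\<close> is the automorphism \<open>\<psi>\<^sub>r\<close> of \<open>D\<^sub>m / C\<^sub>l\<close>. Since the cosets of
  \<open>x = zeta (2 * m)\<close> and \<open>y = qj\<close> generate the quotient, this determines \<open>\<phi>\<close> on all cosets;
  \<open>C\<^sub>l\<close> is the subgroup generated by \<open>x ^ n\<close>, where \<open>n = 2 * m div l\<close>.
\<close>

definition is_psi :: "nat \<Rightarrow> nat \<Rightarrow> nat \<Rightarrow> (quat set \<Rightarrow> quat set) \<Rightarrow> bool" where
  "is_psi m l r \<phi> \<longleftrightarrow>
     (let Q = S3\<lparr>carrier := Dgrp m\<rparr> Mod Cgrp l; x = zeta (2 * m); y = qj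
      in \<phi> \<in> iso Q Q \<and>
         \<phi> (Cgrp l #>\<^bsub>S3\<^esub> x) = Cgrp l #>\<^bsub>S3\<^esub> (x [^]\<^bsub>S3\<^esub> r) \<and>
         \<phi> (Cgrp l #>\<^bsub>S3\<^esub> y) = Cgrp l #>\<^bsub>S3\<^esub> (inv\<^bsub>S3\<^esub> y))"

end

theory Submission
  imports Defs
begin

text \<open>
  A line of \<open>V\<close> other than \<open>\<H>e\<^sub>2\<close> has a slope \<open>b\<close>, meaning that it is spanned by \<open>(1, b)\<close>. In terms
  of slopes \<open>diag(\<xi>, \<eta>)\<close> acts by \<open>b \<mapsto> \<xi>\<^sup>-\<^sup>1 b \<eta>\<close> and the swap by \<open>b \<mapsto> b\<^sup>-\<^sup>1\<close>, so a system of
  imprimitivity other than \<open>{\<H>e\<^sub>1, \<H>e\<^sub>2}\<close> is a pair of distinct non-zero slopes that is stable under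
  inversion and under the three elements \<open>diag(x, x\<^sup>r)\<close>, \<open>diag(j, j\<^sup>-\<^sup>1)\<close> and \<open>diag(1, x\<^sup>n)\<close>, which
  generate the diagonal part of the group. The swap and \<open>diag(j, j\<^sup>-\<^sup>1)\<close> force \<open>b = \<plusminus>1\<close>, \<open>b = \<plusminus>j\<close> or
  \<open>b \<in> \<real>i + \<real>k\<close>; for each candidate the other two elements act by right multiplication with a power
  of \<open>x\<close>, which turns the question into divisibility conditions on \<open>m\<close>, \<open>r\<close> and \<open>l\<close>.
\<close>

section \<open>Lines and slopes\<close>

abbreviation (input) slope_line :: "quat \<Rightarrow> (quat ^ 2) set" where
  "slope_line b \<equiv> left_line (vector [1, b])"

lemma vector2_eq_iff: "(u :: 'a ^ 2) = v \<longleftrightarrow> u $ 1 = v $ 1 \<and> u $ 2 = v $ 2"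
  by (simp add: vec_eq_iff forall_2)

lemma smult_vector2: "c *s (vector [a, b] :: quat ^ 2) = vector [c * a, c * b]"
  by (simp add: vector2_eq_iff)

lemma left_line_smult:
  assumes "c \<noteq> 0"
  shows "left_line (c *s u) = left_line u"
proof -
  have "left_line (d *s u) \<subseteq> left_line u" for d u
    unfolding left_line_def by (force simp: vector_smult_assoc)
  from this[of c u] this[of "inverse c" "c *s u"] assms show ?thesis
    by (simp add: vector_smult_assoc)
qed

lemma left_line_eq_slope_line:
  "p \<noteq> 0 \<Longrightarrow> left_line (vector [p, q]) = slope_line (inverse p * q)"
  using left_line_smult[of p "vector [1, inverse p * q]"]
  by (simp add: smult_vector2 flip: mult.assoc)

lemma left_line_infinity: "q \<noteq> 0 \<Longrightarrow> left_line (vector [0, q]) = left_line (vector [0, 1])"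
  using left_line_smult[of q "vector [0, 1]"] by (simp add: smult_vector2)

text \<open>The first non-zero coordinate of \<open>u\<close> can be scaled to 1; the slope obtained
  this way may be 0.\<close>

lemma left_line_cases:
  obtains (zero) "u = 0" | (slope) b where "left_line u = slope_line b"
  | (infinity) "left_line u = left_line (vector [0, 1])"
proof -
  have "u = vector [u $ 1, u $ 2]"
    by (simp add: vector2_eq_iff)
  then show ?thesis
    using left_line_eq_slope_line[of "u $ 1" "u $ 2"] left_line_infinity[of "u $ 2"] that
    by (metis vector2_eq_iff zero_index)
qed

lemma self_mem_left_line: "u \<in> left_line u"
  unfolding left_line_def by (auto intro: exI[of _ 1])

lemma mem_slope_line_iff: "w \<in> slope_line b \<longleftrightarrow> w $ 2 = w $ 1 * b"
  unfolding left_line_def by (auto simp: smult_vector2 vector2_eq_iff)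

lemma mem_infinity_iff: "w \<in> left_line (vector [0, 1]) \<longleftrightarrow> w $ 1 = 0"
  unfolding left_line_def by (auto simp: smult_vector2 vector2_eq_iff)

lemma slope_line_eq_iff: "slope_line b = slope_line b' \<longleftrightarrow> b = b'"
  using mem_slope_line_iff[of "vector [1, b]" b] mem_slope_line_iff[of "vector [1, b]" b']
  by auto

lemma slope_line_neq_infinity: "slope_line b \<noteq> left_line (vector [0, 1])"
  using mem_slope_line_iff[of "vector [1, b]" b] mem_infinity_iff[of "vector [1, b]"] by auto

lemma slope_lines_eq_iff:
  "{slope_line b, slope_line b'} = {slope_line d, slope_line d'} \<longleftrightarrow> {b, b'} = {d, d'}"
  by (simp add: doubleton_eq_iff slope_line_eq_iff)

lemma left_line_0: "left_line 0 = {0}"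
  unfolding left_line_def by auto

lemma left_line_eq_0_iff: "left_line u = {0} \<longleftrightarrow> u = 0"
  using self_mem_left_line[of u] left_line_0 by auto

lemma left_subspace_left_line: "left_subspace (left_line u)"
  unfolding left_subspace_def
proof (intro conjI ballI allI)
  show "0 \<in> left_line u"
    unfolding left_line_def by (auto intro: exI[of _ 0])
  fix v w assume "v \<in> left_line u" "w \<in> left_line u"
  then obtain p q where "v = p *s u" "w = q *s u"
    unfolding left_line_def by auto
  then have "v + w = (p + q) *s u"
    by (simp add: vector_sadd_rdistrib)
  then show "v + w \<in> left_line u"
    unfolding left_line_def by blast
next
  fix q v assume "v \<in> left_line u"
  then show "q *s v \<in> left_line u"
    unfolding left_line_def by (auto simp: vector_smult_assoc)
qed

lemma image_left_line: "(\<lambda>w. w v* A) ` left_line u = left_line (u v* A)"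
proof -
  have "(q *s u) v* A = q *s (u v* A)" for q
    by (simp add: vec_eq_iff vector_matrix_mult_def sum_distrib_left mult.assoc)
  then show ?thesis
    unfolding left_line_def by (auto simp: image_def)
qed

lemma vector2_mult_diag2: "(vector [a, b] :: quat ^ 2) v* diag2 p q = vector [a * p, b * q]"
  by (simp add: vector2_eq_iff vector_matrix_mult_def diag2_def sum_2)

lemma vector2_mult_diag2_swap2:
  "(vector [a, b] :: quat ^ 2) v* (diag2 p q ** swap2) = vector [b * q, a * p]"
  by (simp add: vector2_eq_iff vector_matrix_mult_def matrix_matrix_mult_def diag2_def swap2_def sum_2)

lemma image_slope_line_diag2:
  "p \<noteq> 0 \<Longrightarrow> (\<lambda>w. w v* diag2 p q) ` slope_line b = slope_line (inverse p * b * q)"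
  by (simp add: image_left_line vector2_mult_diag2 left_line_eq_slope_line[of p] mult.assoc)

text \<open>The vector \<open>(1, b)\<close> goes to \<open>(b q, p)\<close>, of slope
  \<open>inverse (b * q) * p\<close>; a non-zero \<open>b\<close> keeps the image off the infinite
  slope.\<close>

lemma image_slope_line_diag2_swap2:
  assumes "p \<noteq> 0" "q \<noteq> 0" "b \<noteq> 0"
  shows "(\<lambda>w. w v* (diag2 p q ** swap2)) ` slope_line b = slope_line (inverse (inverse p * b * q))"
  using assms
  by (simp add: image_left_line vector2_mult_diag2_swap2 left_line_eq_slope_line[of "b * q"]
      nonzero_inverse_mult_distrib mult.assoc)

lemma slope_lines_Int:
  assumes "b \<noteq> b'"
  shows "slope_line b \<inter> slope_line b' = {0}"
proof -
  have "w = 0" if "w $ 2 = w $ 1 * b" "w $ 2 = w $ 1 * b'" for w :: "quat ^ 2"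
  proof -
    have "w $ 1 * (b - b') = 0"
      using that by (metis diff_self right_diff_distrib)
    then show ?thesis
      using assms that by (auto simp: vector2_eq_iff)
  qed
  then show ?thesis
    by (auto simp: mem_slope_line_iff)
qed

lemma slope_lines_sum:
  assumes "b \<noteq> b'"
  shows "\<exists>u \<in> slope_line b. \<exists>v \<in> slope_line b'. w = u + v"
proof -
  \<comment> \<open>\<open>\<beta>\<close> is the first coordinate of the component of
    \<open>w\<close> on the second line: it solves
    \<open>(w $ 1 - \<beta>) * b + \<beta> * b' = w $ 2\<close>.\<close>
  define \<beta> where "\<beta> = (w $ 2 - w $ 1 * b) * inverse (b' - b)"
  have "\<beta> * (b' - b) = w $ 2 - w $ 1 * b"
    using assms by (simp add: \<beta>_def mult.assoc)
  then have "w = vector [w $ 1 - \<beta>, (w $ 1 - \<beta>) * b] + vector [\<beta>, \<beta> * b']"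
    by (simp add: vector2_eq_iff algebra_simps)
  then show ?thesis
    by (intro bexI[of _ "vector [w $ 1 - \<beta>, (w $ 1 - \<beta>) * b]"] bexI[of _ "vector [\<beta>, \<beta> * b']"])
      (simp_all add: mem_slope_line_iff)
qed

section \<open>From systems of imprimitivity to permutations of two slopes\<close>

lemma imprimitivity_system_line_pair_iff:
  assumes "u \<noteq> 0" "v \<noteq> 0" "left_line u \<inter> left_line v = {0}"
    and "\<And>w. \<exists>v1 \<in> left_line u. \<exists>v2 \<in> left_line v. w = v1 + v2"
  shows "imprimitivity_system G (line_pair u v) \<longleftrightarrow>
    (\<forall>A\<in>G. (\<lambda>W. (\<lambda>w. w v* A) ` W) ` line_pair u v = line_pair u v)"
proof -
  have "\<exists>V1 V2. line_pair u v = {V1, V2} \<and> left_subspace V1 \<and> left_subspace V2 \<and> V1 \<noteq> {0} \<and> V2 \<noteq> {0} \<and>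
      V1 \<inter> V2 = {0} \<and> (\<forall>w. \<exists>v1\<in>V1. \<exists>v2\<in>V2. w = v1 + v2)"
    using assms left_subspace_left_line left_line_eq_0_iff
    by (intro exI[of _ "left_line u"] exI[of _ "left_line v"]) (simp add: line_pair_def)
  then show ?thesis
    unfolding imprimitivity_system_def by simp
qed

lemma axes_Int: "left_line (vector [1, 0]) \<inter> left_line (vector [0, 1]) = {0}"
  by (auto simp: mem_slope_line_iff mem_infinity_iff vector2_eq_iff)

lemma axes_sum: "\<exists>u \<in> left_line (vector [1, 0]). \<exists>v \<in> left_line (vector [0, 1]). w = u + v"
  by (intro bexI[of _ "vector [w $ 1, 0]"] bexI[of _ "vector [0, w $ 2]"])
    (simp_all add: mem_slope_line_iff mem_infinity_iff vector2_eq_iff)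

definition coset_pairs :: "quat set \<Rightarrow> quat set \<Rightarrow> (quat set \<Rightarrow> quat set) \<Rightarrow> (quat \<times> quat) set" where
  "coset_pairs K H \<phi> = {(\<xi>, \<eta>). \<xi> \<in> K \<and> \<eta> \<in> K \<and> \<phi> (H #>\<^bsub>S3\<^esub> \<xi>) = H #>\<^bsub>S3\<^esub> \<eta>}"

text \<open>Keeping the set of pairs as a parameter separates the geometry of slopes from the cosets
  that define the group.\<close>

definition monomial_group :: "(quat \<times> quat) set \<Rightarrow> (quat ^ 2 ^ 2) set" where
  "monomial_group P = (\<Union>(\<xi>, \<eta>) \<in> P. {diag2 \<xi> \<eta>, diag2 \<xi> \<eta> ** swap2})"

lemma G_group_eq_monomial_group: "G_group K H \<phi> = monomial_group (coset_pairs K H \<phi>)"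
proof -
  have "{diag2 \<xi> \<eta> | \<xi> \<eta>. \<xi> \<in> K \<and> \<eta> \<in> K \<and> \<phi> (H #>\<^bsub>S3\<^esub> \<xi>) = H #>\<^bsub>S3\<^esub> \<eta>}
      = (\<lambda>(\<xi>, \<eta>). diag2 \<xi> \<eta>) ` coset_pairs K H \<phi>"
    unfolding coset_pairs_def by auto
  then show ?thesis
    unfolding G_group_def monomial_group_def Let_def by force
qed

lemma ball_monomial_group_iff:
  "(\<forall>A\<in>monomial_group P. Q A) \<longleftrightarrow> (\<forall>\<xi> \<eta>. (\<xi>, \<eta>) \<in> P \<longrightarrow> Q (diag2 \<xi> \<eta>) \<and> Q (diag2 \<xi> \<eta> ** swap2))"
  unfolding monomial_group_def by auto

text \<open>At parameter 0 the lines through \<open>(1, a i)\<close> and \<open>(a i, 1)\<close>,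
  and likewise those through \<open>(1, c k)\<close> and \<open>(c k, 1)\<close>, degenerate to the
  axes. This settles that case.\<close>

lemma imprimitivity_system_axes:
  assumes P: "P \<subseteq> (- {0}) \<times> (- {0})"
  shows "imprimitivity_system (monomial_group P) (line_pair (vector [1, 0]) (vector [0, 1]))"
proof -
  have "(\<lambda>W. (\<lambda>w. w v* diag2 \<xi> \<eta>) ` W) ` line_pair (vector [1, 0]) (vector [0, 1])
      = line_pair (vector [1, 0]) (vector [0, 1]) \<and>
    (\<lambda>W. (\<lambda>w. w v* (diag2 \<xi> \<eta> ** swap2)) ` W) ` line_pair (vector [1, 0]) (vector [0, 1])
      = line_pair (vector [1, 0]) (vector [0, 1])" if "(\<xi>, \<eta>) \<in> P" for \<xi> \<eta>
  proof -
    have "\<xi> \<noteq> 0" "\<eta> \<noteq> 0"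
      using P that by auto
    then have "left_line (vector [\<xi>, 0]) = slope_line 0" "left_line (vector [\<eta>, 0]) = slope_line 0"
      "left_line (vector [0, \<xi>]) = left_line (vector [0, 1])"
      "left_line (vector [0, \<eta>]) = left_line (vector [0, 1])"
      using left_line_eq_slope_line[of \<xi> 0] left_line_eq_slope_line[of \<eta> 0]
        left_line_infinity[of \<xi>] left_line_infinity[of \<eta>] by simp_all
    then show ?thesis
      by (auto simp: line_pair_def image_left_line vector2_mult_diag2 vector2_mult_diag2_swap2)
  qed
  then have "\<forall>A\<in>monomial_group P. (\<lambda>W. (\<lambda>w. w v* A) ` W) ` line_pair (vector [1, 0]) (vector [0, 1])
      = line_pair (vector [1, 0]) (vector [0, 1])"
    unfolding ball_monomial_group_iff by iprover
  moreover have "vector [1, 0] \<noteq> (0 :: quat ^ 2)" "vector [0, 1] \<noteq> (0 :: quat ^ 2)"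
    by (simp_all add: vector2_eq_iff)
  ultimately show ?thesis
    by (subst imprimitivity_system_line_pair_iff[OF _ _ axes_Int axes_sum])
qed

text \<open>The swap inverts slopes, and \<open>(1, 1) \<in> P\<close> puts the bare swap into the
  group. This splits off a single inversion condition from the conditions on diagonal
  matrices.\<close>

lemma imprimitivity_system_slopes_iff:
  assumes P: "P \<subseteq> (- {0}) \<times> (- {0})" "(1, 1) \<in> P"
    and b: "b \<noteq> 0" "b' \<noteq> 0" "b \<noteq> b'"
  shows "imprimitivity_system (monomial_group P) {slope_line b, slope_line b'} \<longleftrightarrow>
    (\<forall>\<xi> \<eta>. (\<xi>, \<eta>) \<in> P \<longrightarrow> (\<lambda>d. inverse \<xi> * d * \<eta>) ` {b, b'} = {b, b'}) \<and> inverse ` {b, b'} = {b, b'}"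
proof -
  let ?S = "{slope_line b, slope_line b'}"
  let ?stab = "\<lambda>A. (\<lambda>W. (\<lambda>w. w v* A) ` W) ` ?S = ?S"
  let ?act = "\<lambda>\<xi> \<eta>. (\<lambda>d. inverse \<xi> * d * \<eta>) ` {b, b'}"
  have nz: "vector [1, d] \<noteq> (0 :: quat ^ 2)" for d
    by (simp add: vector2_eq_iff)
  have "imprimitivity_system (monomial_group P) ?S \<longleftrightarrow> (\<forall>A\<in>monomial_group P. ?stab A)"
    using imprimitivity_system_line_pair_iff[OF nz nz slope_lines_Int[OF b(3)] slope_lines_sum[OF b(3)]]
    unfolding line_pair_def .
  also have "\<dots> \<longleftrightarrow> (\<forall>\<xi> \<eta>. (\<xi>, \<eta>) \<in> P \<longrightarrow> ?stab (diag2 \<xi> \<eta>) \<and> ?stab (diag2 \<xi> \<eta> ** swap2))"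
    by (rule ball_monomial_group_iff)
  also have "\<dots> \<longleftrightarrow> (\<forall>\<xi> \<eta>. (\<xi>, \<eta>) \<in> P \<longrightarrow> ?act \<xi> \<eta> = {b, b'} \<and> inverse ` ?act \<xi> \<eta> = {b, b'})"
  proof -
    have "?stab (diag2 \<xi> \<eta>) \<and> ?stab (diag2 \<xi> \<eta> ** swap2) \<longleftrightarrow>
        ?act \<xi> \<eta> = {b, b'} \<and> inverse ` ?act \<xi> \<eta> = {b, b'}" if "(\<xi>, \<eta>) \<in> P" for \<xi> \<eta>
    proof -
      have "\<xi> \<noteq> 0" "\<eta> \<noteq> 0"
        using P that by auto
      then show ?thesis
        using b by (simp add: image_slope_line_diag2 image_slope_line_diag2_swap2 slope_lines_eq_iff)
    qed
    then show ?thesis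
      by (intro iff_allI imp_cong refl)
  qed
  also have "\<dots> \<longleftrightarrow> (\<forall>\<xi> \<eta>. (\<xi>, \<eta>) \<in> P \<longrightarrow> ?act \<xi> \<eta> = {b, b'}) \<and> inverse ` {b, b'} = {b, b'}" (is "?L \<longleftrightarrow> ?R")
  proof
    assume L: ?L
    then have "\<forall>\<xi> \<eta>. (\<xi>, \<eta>) \<in> P \<longrightarrow> ?act \<xi> \<eta> = {b, b'}"
      by iprover
    moreover have "inverse ` ?act 1 1 = {b, b'}"
      using L P(2) by iprover
    ultimately show ?R
      by simp
  next
    assume R: ?R
    have "?act \<xi> \<eta> = {b, b'} \<and> inverse ` ?act \<xi> \<eta> = {b, b'}" if "(\<xi>, \<eta>) \<in> P" for \<xi> \<eta>
    proof -
      have *: "?act \<xi> \<eta> = {b, b'}"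
        using R that by iprover
      show ?thesis
        unfolding * using R by simp
    qed
    then show ?L
      by iprover
  qed
  finally show ?thesis .
qed

text \<open>If one of the slopes were \<open>0\<close> or infinite, the swap would force the other to be infinite or \<open>0\<close>.\<close>

lemma imprimitivity_system_slopesE:
  assumes sys: "imprimitivity_system (monomial_group P) (line_pair u v)" and P: "(1, 1) \<in> P"
    and nontrivial: "line_pair u v \<noteq> line_pair (vector [1, 0]) (vector [0, 1])"
  obtains b b' where "left_line u = slope_line b" "left_line v = slope_line b'"
    "b \<noteq> 0" "b' \<noteq> 0" "b \<noteq> b'"
proof -
  have "\<exists>V1 V2. {left_line u, left_line v} = {V1, V2} \<and> left_subspace V1 \<and> left_subspace V2 \<and>
      V1 \<noteq> {0} \<and> V2 \<noteq> {0} \<and> V1 \<inter> V2 = {0} \<and> (\<forall>w. \<exists>v1\<in>V1. \<exists>v2\<in>V2. w = v1 + v2)"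
    using sys unfolding imprimitivity_system_def line_pair_def by (rule conjunct1)
  \<comment> \<open>The equation between doubletons fixes \<open>V1\<close> and \<open>V2\<close>
    only up to order, hence a case split.\<close>
  then have "left_line u \<noteq> {0} \<and> left_line v \<noteq> {0} \<and> left_line u \<inter> left_line v = {0}"
    unfolding doubleton_eq_iff by (elim exE conjE disjE) (simp_all only: Int_commute simp_thms)
  then have uv: "u \<noteq> 0" "v \<noteq> 0" and distinct: "left_line u \<noteq> left_line v"
    by (metis left_line_0, metis left_line_0, metis Int_absorb)
  have "diag2 1 1 ** swap2 \<in> monomial_group P"
    using P unfolding monomial_group_def by auto
  moreover have "\<forall>A\<in>monomial_group P. (\<lambda>W. (\<lambda>w. w v* A) ` W) ` {left_line u, left_line v}
      = {left_line u, left_line v}"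
    using sys unfolding imprimitivity_system_def line_pair_def by (rule conjunct2)
  ultimately have stab: "(\<lambda>W. (\<lambda>w. w v* (diag2 1 1 ** swap2)) ` W) ` {left_line u, left_line v}
      = {left_line u, left_line v}"
    by (rule bspec[rotated])
  have swap: "left_line (vector [b, a]) \<in> {left_line u, left_line v}"
    if "left_line (vector [a, b]) \<in> {left_line u, left_line v}" for a b
  proof -
    have "(\<lambda>w. w v* (diag2 1 1 ** swap2)) ` left_line (vector [a, b]) \<in> {left_line u, left_line v}"
      by (subst stab[symmetric]) (rule imageI[OF that])
    then show ?thesis
      by (simp add: image_left_line vector2_mult_diag2_swap2)
  qed
  have no_axis: "left_line (vector [1, 0]) \<notin> {left_line u, left_line v} \<and>
      left_line (vector [0, 1]) \<notin> {left_line u, left_line v}"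
  proof (rule ccontr)
    assume "\<not> ?thesis"
    then have "left_line (vector [0, 1]) \<in> {left_line u, left_line v}"
      "left_line (vector [1, 0]) \<in> {left_line u, left_line v}"
      using swap by blast+
    then have "{left_line u, left_line v} = {left_line (vector [1, 0]), left_line (vector [0, 1])}"
      using slope_line_neq_infinity[of 0] by auto
    then show False
      using nontrivial by (simp add: line_pair_def)
  qed
  obtain b where b: "left_line u = slope_line b"
    using left_line_cases[of u] uv(1) no_axis by (metis insertI1)
  obtain b' where b': "left_line v = slope_line b'"
    using left_line_cases[of v] uv(2) no_axis by (metis insertI1 insertI2)
  show ?thesis
    using that[OF b b'] b b' no_axis distinct by auto
qed

section \<open>Unit quaternions\<close>

lemma quat_1_simps [simp]: "re 1 = 1" "im1 1 = 0" "im2 1 = 0" "im3 1 = 0"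
  by (simp_all add: one_quat_def)

lemma inverse_unit_quat: "qnorm q = 1 \<Longrightarrow> inverse q = qcnj q"
  by (simp add: inverse_quat_def)

section \<open>Roots of unity and their powers\<close>

lemma zeta_components [simp]:
  "re (zeta q) = cos (2 * pi / real q)" "im1 (zeta q) = sin (2 * pi / real q)"
  "im2 (zeta q) = 0" "im3 (zeta q) = 0"
  by (simp_all add: zeta_def qi_def quat_ops_def)

lemma zeta_power:
  "zeta q ^ k = Quat (cos (2 * pi * real k / real q)) (sin (2 * pi * real k / real q)) 0 0"
proof (induction k)
  case 0
  then show ?case
    by (simp add: one_quat_def)
next
  case (Suc k)
  have "2 * pi * real (Suc k) / real q = 2 * pi / real q + 2 * pi * real k / real q"
    by (simp add: algebra_simps add_divide_distrib)
  then show ?case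
    by (simp add: Suc times_quat_def cos_add sin_add)
qed

lemma qnorm_zeta: "qnorm (zeta q) = 1"
  by (simp add: qnorm_def)

text \<open>Cosine 1 already forces sine 0, so the angle only has to be an integral multiple of
  \<open>2 * pi\<close>.\<close>

lemma zeta_power_eq_1_iff:
  assumes "q > 0"
  shows "zeta q ^ k = 1 \<longleftrightarrow> q dvd k"
proof -
  have "zeta q ^ k = 1 \<longleftrightarrow> cos (2 * pi * real k / real q) = 1"
    using sin_cos_squared_add[of "2 * pi * real k / real q"]
    by (auto simp: zeta_power one_quat_def simp del: sin_cos_squared_add)
  also have "\<dots> \<longleftrightarrow> (\<exists>i::int. 2 * pi * real k / real q = real_of_int i * 2 * pi)"
    by (rule cos_one_2pi_int)
  also have "\<dots> \<longleftrightarrow> (\<exists>i::int. int k = int q * i)"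
  proof (rule ex_cong1)
    fix i :: int
    have "2 * pi * real k / real q = real_of_int i * 2 * pi \<longleftrightarrow> real k = real q * real_of_int i"
      using assms by (simp add: field_simps)
    also have "\<dots> \<longleftrightarrow> int k = int q * i"
      by (metis of_int_eq_iff of_int_mult of_int_of_nat_eq)
    finally show "2 * pi * real k / real q = real_of_int i * 2 * pi \<longleftrightarrow> int k = int q * i" .
  qed
  also have "\<dots> \<longleftrightarrow> q dvd k"
    unfolding dvd_def[symmetric] by simp
  finally show ?thesis .
qed

lemma zeta_power_mult: "q > 0 \<Longrightarrow> zeta (q * d) ^ d = zeta q" if "d > 0"
  using that by (simp add: zeta_power quat_eq_iff)

section \<open>The cyclic and binary dihedral subgroups of the unit quaternions\<close>

lemma S3_simps [simp]:
  "carrier S3 = {q. qnorm q = 1}" "p \<otimes>\<^bsub>S3\<^esub> q = p * q" "\<one>\<^bsub>S3\<^esub> = 1"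
  by (simp_all add: S3_def)

lemma S3_pow: "q [^]\<^bsub>S3\<^esub> (k :: nat) = q ^ k"
  by (induction k) (simp_all add: nat_pow_def power_commutes)

lemma qnorm_1 [simp]: "qnorm 1 = 1"
  by (simp add: qnorm_def)

lemma qnorm_eq_1_imp_nonzero: "qnorm q = 1 \<Longrightarrow> q \<noteq> 0"
  by (auto simp: qnorm_def zero_quat_def)

lemma S3_inv: "qnorm q = 1 \<Longrightarrow> inv\<^bsub>S3\<^esub> q = inverse q"
proof -
  assume q: "qnorm q = 1"
  then have "qnorm (inverse q) = 1"
    by (simp add: inverse_unit_quat) (simp add: qnorm_def qcnj_def)
  then show ?thesis
    using q group.inv_equality[OF group_S3, of "inverse q" q] qnorm_eq_1_imp_nonzero[OF q] by simp
qed

lemma qj_simps [simp]: "qnorm qj = 1" "re qj = 0" "im1 qj = 0" "im2 qj = 1" "im3 qj = 0"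
  by (simp_all add: qnorm_def qj_def)

lemma subgroup_Cgrp: "subgroup (Cgrp l) S3"
  unfolding Cgrp_def by (rule group.generate_is_subgroup[OF group_S3]) (simp add: qnorm_zeta)

lemma subgroup_Dgrp: "subgroup (Dgrp m) S3"
  unfolding Dgrp_def by (rule group.generate_is_subgroup[OF group_S3]) (simp add: qnorm_zeta)

lemma Dgrp_power: "q \<in> Dgrp m \<Longrightarrow> q ^ k \<in> Dgrp m"
  using subgroup.one_closed[OF subgroup_Dgrp] subgroup.m_closed[OF subgroup_Dgrp]
  by (induction k) auto

lemma Cgrp_complex: "q \<in> Cgrp l \<Longrightarrow> im2 q = 0 \<and> im3 q = 0"
  unfolding Cgrp_def
  by (induction q rule: generate.induct)
    (auto simp: S3_inv qnorm_zeta inverse_unit_quat qcnj_def times_quat_def)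

text \<open>The union of the complex numbers C with Cj contains both generators and is closed under
  products and under conjugation, which inverts unit quaternions.\<close>

lemma Dgrp_dichotomy: "q \<in> Dgrp m \<Longrightarrow> im2 q = 0 \<and> im3 q = 0 \<or> re q = 0 \<and> im1 q = 0"
  unfolding Dgrp_def
  by (induction q rule: generate.induct)
    (auto simp: S3_inv qnorm_zeta inverse_unit_quat qcnj_def times_quat_def)

lemma Cgrp_subset_Dgrp:
  assumes "l dvd 2 * m" "m > 0"
  shows "Cgrp l \<subseteq> Dgrp m"
  unfolding Cgrp_def
proof (rule group.generate_subgroup_incl[OF group_S3 _ subgroup_Dgrp])
  obtain d where d: "2 * m = l * d"
    using assms(1) by auto
  have "zeta (2 * m) \<in> Dgrp m"
    unfolding Dgrp_def by (rule generate.incl) simp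
  then have "zeta (2 * m) ^ d \<in> Dgrp m"
    by (rule Dgrp_power)
  moreover have "zeta (2 * m) ^ d = zeta l"
    using zeta_power_mult[of d l] d assms(2) by (cases d; cases l) auto
  ultimately show "{zeta l} \<subseteq> Dgrp m"
    by simp
qed

text \<open>An element of \<open>D\<^sub>m\<close> commutes with \<open>h \<in> C\<^sub>l\<close> or conjugates it to \<open>h\<^sup>-\<^sup>1\<close>.\<close>

lemma Cgrp_normal:
  assumes "l dvd 2 * m" "m > 0"
  shows "Cgrp l \<lhd> S3\<lparr>carrier := Dgrp m\<rparr>"
proof -
  interpret D: group "S3\<lparr>carrier := Dgrp m\<rparr>"
    by (rule group.subgroup_imp_group[OF group_S3 subgroup_Dgrp])
  show ?thesis
    unfolding D.normal_inv_iff
  proof (intro conjI ballI)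
    show "subgroup (Cgrp l) (S3\<lparr>carrier := Dgrp m\<rparr>)"
      by (rule group.subgroup_incl[OF group_S3 subgroup_Cgrp subgroup_Dgrp Cgrp_subset_Dgrp[OF assms]])
  next
    fix \<xi> h assume "\<xi> \<in> carrier (S3\<lparr>carrier := Dgrp m\<rparr>)" and h: "h \<in> Cgrp l"
    then have \<xi>: "\<xi> \<in> Dgrp m"
      by simp
    then have unit: "qnorm \<xi> = 1" "qnorm h = 1"
      using h subgroup.mem_carrier[OF subgroup_Dgrp] subgroup.mem_carrier[OF subgroup_Cgrp] by auto
    have "\<xi> * h = h * \<xi> \<or> \<xi> * h = inverse h * \<xi>"
      using Dgrp_dichotomy[OF \<xi>] Cgrp_complex[OF h] unit
      by (auto simp: inverse_unit_quat quat_eq_iff times_quat_def qcnj_def)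
    then have "\<xi> * h * inverse \<xi> = h \<or> \<xi> * h * inverse \<xi> = inverse h"
      using qnorm_eq_1_imp_nonzero[OF unit(1)] by (elim disjE) (simp_all add: mult.assoc)
    moreover have "inverse h \<in> Cgrp l"
      using subgroup.m_inv_closed[OF subgroup_Cgrp h] S3_inv[OF unit(2)] by simp
    ultimately have "\<xi> * h * inverse \<xi> \<in> Cgrp l"
      using h by (elim disjE) simp_all
    then show "\<xi> \<otimes>\<^bsub>S3\<lparr>carrier := Dgrp m\<rparr>\<^esub> h \<otimes>\<^bsub>S3\<lparr>carrier := Dgrp m\<rparr>\<^esub> inv\<^bsub>S3\<lparr>carrier := Dgrp m\<rparr>\<^esub> \<xi> \<in> Cgrp l"
      using group.m_inv_consistent[OF group_S3 subgroup_Dgrp \<xi>] S3_inv[OF unit(1)] by simp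
  qed
qed

section \<open>Norms, conjugation, and roots of unity that act as a sign\<close>

lemma qnorm_scaleR: "qnorm (t *\<^sub>R q) = \<bar>t\<bar> * qnorm q"
proof -
  have "(qnorm (t *\<^sub>R q))\<^sup>2 = (\<bar>t\<bar> * qnorm q)\<^sup>2"
    unfolding power_mult_distrib qnorm_square by (simp add: scaleR_quat_def power_mult_distrib algebra_simps)
  then show ?thesis
    by (simp add: power2_eq_iff_nonneg qnorm_def)
qed

lemma qnorm_power: "qnorm (q ^ k) = qnorm q ^ k"
  by (induction k) (simp_all add: qnorm_mult)

lemma qcnj_mult: "qcnj (p * q) = qcnj q * qcnj p"
  by (simp add: qcnj_def times_quat_def quat_eq_iff)

text \<open>The image of \<open>b\<close> is \<open>b\<close> or \<open>- s *\<^sub>R b\<close>, and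
  cancelling \<open>b\<close> makes \<open>w\<close> equal to 1 or to the real number
  \<open>- s\<close>; norm 1 then forces \<open>s = 1\<close> in the second case.\<close>

lemma image_mult_right_homothetic_iff:
  assumes "b \<noteq> 0" "s > 0" "qnorm w = 1"
  shows "(\<lambda>d. d * w) ` {b, - s *\<^sub>R b} = {b, - s *\<^sub>R b} \<longleftrightarrow> w = 1 \<or> w = -1 \<and> s = 1"
proof
  assume "(\<lambda>d. d * w) ` {b, - s *\<^sub>R b} = {b, - s *\<^sub>R b}"
  then have "b * w = b \<or> b * w = - s *\<^sub>R b"
    by auto
  then have "b * w = b * 1 \<or> b * w = b * (- s *\<^sub>R 1)"
    by simp
  then have w: "w = 1 \<or> w = - s *\<^sub>R 1"
    using \<open>b \<noteq> 0\<close> by (metis mult_left_cancel)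
  moreover have "s = 1" if "w = - s *\<^sub>R 1"
    using assms(2,3) unfolding that qnorm_scaleR by simp
  ultimately show "w = 1 \<or> w = -1 \<and> s = 1"
    by auto
next
  assume "w = 1 \<or> w = -1 \<and> s = 1"
  then show "(\<lambda>d. d * w) ` {b, - s *\<^sub>R b} = {b, - s *\<^sub>R b}"
    by auto
qed

text \<open>In a division ring 1 and -1 are the only square roots of 1, so the condition becomes
  \<open>2 * m dvd 2 * k\<close>.\<close>

lemma zeta_power_eq_pm1_iff:
  assumes "m > 0"
  shows "zeta (2 * m) ^ k = 1 \<or> zeta (2 * m) ^ k = -1 \<longleftrightarrow> m dvd k"
proof -
  have "zeta (2 * m) ^ k = 1 \<or> zeta (2 * m) ^ k = -1 \<longleftrightarrow> zeta (2 * m) ^ (2 * k) = 1"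
    unfolding mult_2 power_add square_eq_1_iff ..
  then show ?thesis
    using assms by (simp add: zeta_power_eq_1_iff)
qed

lemma zeta_eq_1_iff: "l > 0 \<Longrightarrow> zeta l = 1 \<longleftrightarrow> l = 1"
  using zeta_power_eq_1_iff[of l 1] by simp

lemma dvd_2_iff: "l dvd 2 \<longleftrightarrow> l = 1 \<or> l = (2 :: nat)"
  using two_is_prime_nat by (auto simp: prime_nat_iff)

lemma zeta_eq_pm1_iff:
  assumes "l > 0"
  shows "zeta l = 1 \<or> zeta l = -1 \<longleftrightarrow> l = 1 \<or> l = 2"
proof -
  have "zeta l = 1 \<or> zeta l = -1 \<longleftrightarrow> zeta l ^ 2 = 1"
    by (simp add: power2_eq_square square_eq_1_iff)
  then show ?thesis
    using assms by (simp add: zeta_power_eq_1_iff dvd_2_iff)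
qed

lemma qi_simps [simp]: "re qi = 0" "im1 qi = 1" "im2 qi = 0" "im3 qi = 0"
  by (simp_all add: qi_def)

lemma qk_simps [simp]: "re qk = 0" "im1 qk = 0" "im2 qk = 0" "im3 qk = 1"
  by (simp_all add: qk_def)

text \<open>Conjugation negates a pure quaternion. A slope \<open>b\<close> of this kind and its
  inverse thus form a pair \<open>{b, - s *\<^sub>R b}\<close> with real \<open>s\<close>.\<close>

lemma inverse_pure: "re b = 0 \<Longrightarrow> inverse b = - (1 / (qnorm b)\<^sup>2) *\<^sub>R b"
  by (simp add: inverse_quat_def qcnj_def scaleR_quat_def quat_eq_iff)

lemma inverse_zeta: "inverse (zeta q) = qcnj (zeta q)"
  by (rule inverse_unit_quat[OF qnorm_zeta])

text \<open>The unit \<open>i\<close> commutes with complex numbers, while \<open>j\<close> and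
  \<open>k\<close> conjugate them; this moves a left factor to the right of a slope.\<close>

lemma qcnj_zeta_conj:
  "qcnj (zeta q) * (a *\<^sub>R qi) = a *\<^sub>R qi * qcnj (zeta q)"
  "qcnj (zeta q) * qj = qj * zeta q"
  "qcnj (zeta q) * (c *\<^sub>R qk) = c *\<^sub>R qk * zeta q"
  by (simp_all add: quat_eq_iff times_quat_def qcnj_def scaleR_quat_def)

section \<open>Generators of the diagonal part\<close>

text \<open>A stabilizer for the right action of pairs on slopes. Restricting to non-zero entries
  makes it closed under products and inverses.\<close>

definition slope_stabilizer :: "quat set \<Rightarrow> (quat \<times> quat) set" where
  "slope_stabilizer S = {(\<xi>, \<eta>). \<xi> \<noteq> 0 \<and> \<eta> \<noteq> 0 \<and> (\<lambda>d. inverse \<xi> * d * \<eta>) ` S = S}"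

lemma slope_stabilizer_1: "(1, 1) \<in> slope_stabilizer S"
  by (simp add: slope_stabilizer_def)

lemma slope_stabilizer_mult:
  assumes "(\<xi>, \<eta>) \<in> slope_stabilizer S" "(\<xi>', \<eta>') \<in> slope_stabilizer S"
  shows "(\<xi> * \<xi>', \<eta> * \<eta>') \<in> slope_stabilizer S"
proof -
  have nz: "\<xi> \<noteq> 0" "\<eta> \<noteq> 0" "\<xi>' \<noteq> 0" "\<eta>' \<noteq> 0"
    and S: "(\<lambda>d. inverse \<xi> * d * \<eta>) ` S = S" "(\<lambda>d. inverse \<xi>' * d * \<eta>') ` S = S"
    using assms by (simp_all add: slope_stabilizer_def)
  have "(\<lambda>d. inverse (\<xi> * \<xi>') * d * (\<eta> * \<eta>')) ` S
      = (\<lambda>d. inverse \<xi>' * d * \<eta>') ` (\<lambda>d. inverse \<xi> * d * \<eta>) ` S"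
    using nz by (simp add: image_image nonzero_inverse_mult_distrib mult.assoc)
  also have "\<dots> = S"
    by (simp only: S)
  finally show ?thesis
    using nz by (simp add: slope_stabilizer_def)
qed

lemma slope_stabilizer_inverse:
  assumes "(\<xi>, \<eta>) \<in> slope_stabilizer S"
  shows "(inverse \<xi>, inverse \<eta>) \<in> slope_stabilizer S"
proof -
  have nz: "\<xi> \<noteq> 0" "\<eta> \<noteq> 0" and S: "(\<lambda>d. inverse \<xi> * d * \<eta>) ` S = S"
    using assms by (auto simp: slope_stabilizer_def)
  have "(\<lambda>d. inverse (inverse \<xi>) * d * inverse \<eta>) ` S
      = (\<lambda>d. inverse (inverse \<xi>) * d * inverse \<eta>) ` (\<lambda>d. inverse \<xi> * d * \<eta>) ` S"
    by (simp only: S)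
  also have "\<dots> = (\<lambda>d. (\<xi> * inverse \<xi>) * d * (\<eta> * inverse \<eta>)) ` S"
    unfolding image_image nonzero_inverse_inverse_eq[OF nz(1)] by (simp only: mult.assoc)
  also have "\<dots> = S"
    using nz by simp
  finally show ?thesis
    using nz by (simp add: slope_stabilizer_def)
qed

text \<open>The bound \<open>1 \<le> r\<close> makes the truncated difference \<open>r - 1\<close>
  the true exponent. Admissibility enters only when the resulting divisibility conditions are
  evaluated.\<close>

locale standard_copy =
  fixes m l r :: nat and \<psi> :: "quat set \<Rightarrow> quat set"
  assumes m: "1 \<le> m" and l: "1 \<le> l" and r: "1 \<le> r" and l_dvd: "l dvd 2 * m" and psi: "is_psi m l r \<psi>"
begin

abbreviation "z \<equiv> zeta (2 * m)"
abbreviation "h \<equiv> zeta l"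
abbreviation "D \<equiv> S3\<lparr>carrier := Dgrp m\<rparr>"
abbreviation "H \<equiv> Cgrp l"

sublocale S3: group S3
  by (rule group_S3)

sublocale D: group D
  by (rule S3.subgroup_imp_group[OF subgroup_Dgrp])

sublocale H: normal H D
  using Cgrp_normal l_dvd m by simp

sublocale Q: group_hom "D Mod H" "D Mod H" \<psi>
  using psi unfolding is_psi_def Let_def group_hom_def group_hom_axioms_def iso_def
  by (auto intro: H.factorgroup_is_group)

lemma r_coset_D [simp]: "X #>\<^bsub>D\<^esub> \<xi> = X #>\<^bsub>S3\<^esub> \<xi>"
  by (simp add: r_coset_def)

definition pairs :: "(quat \<times> quat) set" where
  "pairs = coset_pairs (Dgrp m) H \<psi>"

lemma mem_pairs_iff:
  "(\<xi>, \<eta>) \<in> pairs \<longleftrightarrow> \<xi> \<in> Dgrp m \<and> \<eta> \<in> Dgrp m \<and> \<psi> (H #>\<^bsub>S3\<^esub> \<xi>) = H #>\<^bsub>S3\<^esub> \<eta>"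
  by (simp add: pairs_def coset_pairs_def)

lemma Dgrp_unit: "\<xi> \<in> Dgrp m \<Longrightarrow> qnorm \<xi> = 1"
  using subgroup.mem_carrier[OF subgroup_Dgrp] by simp

lemma pairs_subset: "pairs \<subseteq> (- {0}) \<times> (- {0})"
proof -
  have "0 \<notin> Dgrp m"
    using Dgrp_unit qnorm_eq_1_imp_nonzero by blast
  then show ?thesis
    by (auto simp: mem_pairs_iff)
qed

lemma coset_mem_carrier: "\<xi> \<in> Dgrp m \<Longrightarrow> H #>\<^bsub>S3\<^esub> \<xi> \<in> carrier (D Mod H)"
  using D.rcosetsI[OF H.subset, of \<xi>] by (simp add: FactGroup_def)

text \<open>The pairs are the preimage, in two copies of \<open>Dgrp m\<close>, of the graph of the
  homomorphism \<open>\<psi>\<close> on the quotient, and such a preimage is a subgroup.\<close>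

lemma pairs_mult:
  assumes "(\<xi>, \<eta>) \<in> pairs" "(\<xi>', \<eta>') \<in> pairs"
  shows "(\<xi> * \<xi>', \<eta> * \<eta>') \<in> pairs"
  unfolding mem_pairs_iff
proof (intro conjI)
  have mem: "\<xi> \<in> Dgrp m" "\<eta> \<in> Dgrp m" "\<xi>' \<in> Dgrp m" "\<eta>' \<in> Dgrp m"
    using assms by (auto simp: mem_pairs_iff)
  then show "\<xi> * \<xi>' \<in> Dgrp m" "\<eta> * \<eta>' \<in> Dgrp m"
    using subgroup.m_closed[OF subgroup_Dgrp] by force+
  have "\<psi> (H #>\<^bsub>S3\<^esub> (\<xi> * \<xi>')) = \<psi> ((H #>\<^bsub>S3\<^esub> \<xi>) \<otimes>\<^bsub>D Mod H\<^esub> (H #>\<^bsub>S3\<^esub> \<xi>'))"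
    using mem H.rcos_sum[of \<xi> \<xi>'] by (simp add: FactGroup_def)
  also have "\<dots> = (H #>\<^bsub>S3\<^esub> \<eta>) \<otimes>\<^bsub>D Mod H\<^esub> (H #>\<^bsub>S3\<^esub> \<eta>')"
    using assms mem by (subst Q.hom_mult) (simp_all add: coset_mem_carrier mem_pairs_iff)
  also have "\<dots> = H #>\<^bsub>S3\<^esub> (\<eta> * \<eta>')"
    using mem H.rcos_sum[of \<eta> \<eta>'] by (simp add: FactGroup_def)
  finally show "\<psi> (H #>\<^bsub>S3\<^esub> (\<xi> * \<xi>')) = H #>\<^bsub>S3\<^esub> (\<eta> * \<eta>')" .
qed

lemma coset_inverse:
  assumes "\<xi> \<in> Dgrp m"
  shows "inv\<^bsub>D Mod H\<^esub> (H #>\<^bsub>S3\<^esub> \<xi>) = H #>\<^bsub>S3\<^esub> inverse \<xi>"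
  using H.inv_FactGroup[OF coset_mem_carrier[OF assms]] H.rcos_inv[of \<xi>] assms
    S3.m_inv_consistent[OF subgroup_Dgrp assms] S3_inv[OF Dgrp_unit[OF assms]] by simp

lemma pairs_inverse:
  assumes "(\<xi>, \<eta>) \<in> pairs"
  shows "(inverse \<xi>, inverse \<eta>) \<in> pairs"
  unfolding mem_pairs_iff
proof (intro conjI)
  have mem: "\<xi> \<in> Dgrp m" "\<eta> \<in> Dgrp m"
    using assms by (auto simp: mem_pairs_iff)
  then show "inverse \<xi> \<in> Dgrp m" "inverse \<eta> \<in> Dgrp m"
    using subgroup.m_inv_closed[OF subgroup_Dgrp] S3_inv Dgrp_unit by metis+
  show "\<psi> (H #>\<^bsub>S3\<^esub> inverse \<xi>) = H #>\<^bsub>S3\<^esub> inverse \<eta>"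
    using Q.hom_inv[OF coset_mem_carrier[OF mem(1)]] mem assms coset_inverse
    by (simp add: mem_pairs_iff)
qed

lemma generators_mem: "z \<in> Dgrp m" "qj \<in> Dgrp m" "h \<in> H"
  by (auto simp: Dgrp_def Cgrp_def intro: generate.incl)

lemma H_subset: "H \<subseteq> Dgrp m"
  using H.subset by simp

lemma pairs_1: "\<eta> \<in> H \<Longrightarrow> (1, \<eta>) \<in> pairs"
proof -
  assume \<eta>: "\<eta> \<in> H"
  have coset: "H #>\<^bsub>S3\<^esub> \<xi> = H" if "\<xi> \<in> H" for \<xi>
    using D.coset_join2[OF _ H.is_subgroup that] that H_subset by auto
  have one: "1 \<in> H"
    using subgroup.one_closed[OF subgroup_Cgrp] by simp
  have "\<psi> H = H"
    using Q.hom_one by simp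
  then show ?thesis
    using \<eta> one H_subset coset by (auto simp: mem_pairs_iff)
qed

lemma pairs_z: "(z, z ^ r) \<in> pairs"
  using psi generators_mem Dgrp_power[OF generators_mem(1), of r]
  unfolding is_psi_def Let_def mem_pairs_iff by (simp add: S3_pow)

lemma inverse_qj: "inverse qj = - qj"
  by (simp add: inverse_unit_quat) (simp add: qcnj_def qj_def quat_ops_def)

lemma pairs_j: "(qj, - qj) \<in> pairs"
  using psi generators_mem subgroup.m_inv_closed[OF subgroup_Dgrp generators_mem(2)]
  unfolding is_psi_def Let_def mem_pairs_iff by (simp add: S3_inv inverse_qj)

text \<open>Both partners of \<open>\<xi>\<close> represent the coset
  \<open>\<psi> (H #> \<xi>)\<close>, so they differ by a left factor from \<open>H\<close>.\<close>

lemma pairs_cosetD: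
  assumes "(\<xi>, \<eta>) \<in> pairs" "(\<xi>, \<eta>') \<in> pairs"
  obtains d where "d \<in> H" "\<eta>' = d * \<eta>"
proof -
  have "\<eta>' \<in> H #>\<^bsub>S3\<^esub> \<eta>"
    using assms D.rcos_self[OF _ H.is_subgroup, of \<eta>'] by (auto simp: mem_pairs_iff)
  then show ?thesis
    using that by (auto simp: r_coset_def)
qed

text \<open>Induction over \<open>Dgrp m\<close> gives each \<open>\<xi>\<close> one partner in the
  stabilizer. Any other partner differs from it by a pair \<open>(1, d)\<close> with
  \<open>d \<in> H\<close>, and powers of \<open>(1, h)\<close> account for these.\<close>

lemma pairs_subset_slope_stabilizer_iff:
  "pairs \<subseteq> slope_stabilizer S \<longleftrightarrow> (z, z ^ r) \<in> slope_stabilizer S \<and>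
     (qj, - qj) \<in> slope_stabilizer S \<and> (1, h) \<in> slope_stabilizer S"
proof
  assume "pairs \<subseteq> slope_stabilizer S"
  then show "(z, z ^ r) \<in> slope_stabilizer S \<and>
      (qj, - qj) \<in> slope_stabilizer S \<and> (1, h) \<in> slope_stabilizer S"
    using pairs_z pairs_j pairs_1[OF generators_mem(3)] by auto
next
  assume gens: "(z, z ^ r) \<in> slope_stabilizer S \<and>
      (qj, - qj) \<in> slope_stabilizer S \<and> (1, h) \<in> slope_stabilizer S"
  have D: "\<exists>\<eta>. (\<xi>, \<eta>) \<in> pairs \<and> (\<xi>, \<eta>) \<in> slope_stabilizer S" if "\<xi> \<in> generate S3 {z, qj}" for \<xi>
    using that
  proof (induction \<xi> rule: generate.induct)
    case one
    then show ?case
      using pairs_1[OF H.one_closed] slope_stabilizer_1 by auto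
  next
    case (incl g)
    then show ?case
      using gens pairs_z pairs_j by auto
  next
    case (inv g)
    then have "qnorm g = 1"
      using qnorm_zeta by auto
    moreover obtain \<eta> where "(g, \<eta>) \<in> pairs" "(g, \<eta>) \<in> slope_stabilizer S"
      using inv gens pairs_z pairs_j by auto
    ultimately show ?case
      using pairs_inverse slope_stabilizer_inverse by (metis S3_inv)
  next
    case (eng g g')
    then show ?case
      using pairs_mult slope_stabilizer_mult by (metis S3_simps(2))
  qed
  have H: "(1, \<eta>) \<in> slope_stabilizer S" if "\<eta> \<in> generate S3 {h}" for \<eta>
    using that
  proof (induction \<eta> rule: generate.induct)
    case one
    then show ?case
      using slope_stabilizer_1 by simp
  next
    case (incl g)
    then show ?case
      using gens by simp
  next
    case (inv g)
    then show ?case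
      using gens slope_stabilizer_inverse[of 1 h S] by (simp add: S3_inv qnorm_zeta)
  next
    case (eng g g')
    then show ?case
      using slope_stabilizer_mult[of 1 g S 1 g'] by simp
  qed
  show "pairs \<subseteq> slope_stabilizer S"
  proof clarify
    fix \<xi> \<eta>' assume p: "(\<xi>, \<eta>') \<in> pairs"
    then obtain \<eta> where \<eta>: "(\<xi>, \<eta>) \<in> pairs" "(\<xi>, \<eta>) \<in> slope_stabilizer S"
      using D[of \<xi>] by (auto simp: mem_pairs_iff Dgrp_def)
    then obtain d where "d \<in> H" "\<eta>' = d * \<eta>"
      using pairs_cosetD p by metis
    then show "(\<xi>, \<eta>') \<in> slope_stabilizer S"
      using slope_stabilizer_mult[OF H[of d] \<eta>(2)] by (simp add: Cgrp_def)
  qed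
qed

end

section \<open>Stable pairs of slopes\<close>

context standard_copy
begin

abbreviation "sys \<equiv> imprimitivity_system (monomial_group pairs)"

text \<open>Moved to the right, \<open>inverse z\<close> stays itself past \<open>1\<close> and
  \<open>i\<close> but turns into \<open>z\<close> past \<open>j\<close> and \<open>k\<close>; hence
  the exponents \<open>r - 1\<close> and \<open>r + 1\<close>.\<close>

lemma z_conj:
  "inverse z * 1 * z ^ r = 1 * z ^ (r - 1)"
  "inverse z * (a *\<^sub>R qi) * z ^ r = a *\<^sub>R qi * z ^ (r - 1)"
  "inverse z * qj * z ^ r = qj * z ^ (r + 1)"
  "inverse z * (c *\<^sub>R qk) * z ^ r = c *\<^sub>R qk * z ^ (r + 1)"
proof -
  have z: "z \<noteq> 0"
    using qnorm_zeta qnorm_eq_1_imp_nonzero by auto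
  have "inverse z * z ^ r = inverse z * z * z ^ (r - 1)"
    using r by (simp add: power_eq_if mult.assoc)
  then have *: "inverse z * z ^ r = z ^ (r - 1)"
    using z by simp
  then show "inverse z * 1 * z ^ r = 1 * z ^ (r - 1)"
    by simp
  show "inverse z * (a *\<^sub>R qi) * z ^ r = a *\<^sub>R qi * z ^ (r - 1)"
    unfolding inverse_zeta qcnj_zeta_conj mult.assoc by (simp only: * flip: inverse_zeta)
  show "inverse z * qj * z ^ r = qj * z ^ (r + 1)"
    "inverse z * (c *\<^sub>R qk) * z ^ r = c *\<^sub>R qk * z ^ (r + 1)"
    unfolding inverse_zeta qcnj_zeta_conj by (simp_all add: mult.assoc)
qed

text \<open>The pair \<open>(qj, - qj)\<close> acts by
  \<open>d \<mapsto> (- qj) * d * (- qj)\<close>, in which the signs cancel.\<close>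

lemma sys_slopes_iff:
  assumes "b \<noteq> 0" "b' \<noteq> 0" "b \<noteq> b'"
  shows "sys {slope_line b, slope_line b'} \<longleftrightarrow>
    (\<lambda>d. inverse z * d * z ^ r) ` {b, b'} = {b, b'} \<and> (\<lambda>d. qj * d * qj) ` {b, b'} = {b, b'} \<and>
    (\<lambda>d. d * h) ` {b, b'} = {b, b'} \<and> inverse ` {b, b'} = {b, b'}"
proof -
  have nz: "\<xi> \<noteq> 0 \<and> \<eta> \<noteq> 0" if "(\<xi>, \<eta>) \<in> pairs" for \<xi> \<eta>
    using that pairs_subset by auto
  have "(\<forall>\<xi> \<eta>. (\<xi>, \<eta>) \<in> pairs \<longrightarrow> (\<lambda>d. inverse \<xi> * d * \<eta>) ` {b, b'} = {b, b'}) \<longleftrightarrow>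
      pairs \<subseteq> slope_stabilizer {b, b'}"
    unfolding subset_iff split_paired_All slope_stabilizer_def mem_Collect_eq prod.case
    by (intro iff_allI imp_cong refl) (drule nz, simp only: simp_thms)
  then have "sys {slope_line b, slope_line b'} \<longleftrightarrow>
      pairs \<subseteq> slope_stabilizer {b, b'} \<and> inverse ` {b, b'} = {b, b'}"
    unfolding imprimitivity_system_slopes_iff[OF pairs_subset pairs_1[OF H.one_closed, simplified] assms]
    by (simp only:)
  also have "\<dots> \<longleftrightarrow> (\<lambda>d. inverse z * d * z ^ r) ` {b, b'} = {b, b'} \<and>
      (\<lambda>d. qj * d * qj) ` {b, b'} = {b, b'} \<and>
      (\<lambda>d. d * h) ` {b, b'} = {b, b'} \<and> inverse ` {b, b'} = {b, b'}"
  proof -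
    have "z \<noteq> 0" "h \<noteq> 0" "qj \<noteq> 0"
      using qnorm_zeta qnorm_eq_1_imp_nonzero by auto
    then show ?thesis
      unfolding pairs_subset_slope_stabilizer_iff
      by (simp add: slope_stabilizer_def inverse_qj del: image_insert)
  qed
  finally show ?thesis .
qed

text \<open>The condition \<open>s = 1\<close> is what decides whether an element acting as \<open>-1\<close> on slopes is harmless.\<close>

lemma sys_homothetic_iff:
  assumes b: "b \<noteq> 0" and s: "s > 0"
    and swap: "inverse ` {b, - s *\<^sub>R b} = {b, - s *\<^sub>R b}"
    and j: "(\<lambda>d. qj * d * qj) ` {b, - s *\<^sub>R b} = {b, - s *\<^sub>R b}"
    and z: "inverse z * b * z ^ r = b * z ^ e"
  shows "sys {slope_line b, slope_line (- s *\<^sub>R b)} \<longleftrightarrow>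
    (if s = 1 then m dvd e \<and> (l = 1 \<or> l = 2) else 2 * m dvd e \<and> l = 1)"
proof -
  have "- s *\<^sub>R b \<noteq> 0"
    using b s by simp
  moreover have "b \<noteq> - s *\<^sub>R b"
  proof
    assume "b = - s *\<^sub>R b"
    then have "1 *\<^sub>R b = - s *\<^sub>R b"
      by (subst scaleR_one)
    with b have "1 = - s"
      by (rule scaleR_right_imp_eq)
    then show False
      using s by simp
  qed
  moreover have act_z: "(\<lambda>d. inverse z * d * z ^ r) ` {b, - s *\<^sub>R b} = (\<lambda>d. d * z ^ e) ` {b, - s *\<^sub>R b}"
    using z by simp
  moreover have "qnorm (z ^ e) = 1"
    by (simp add: qnorm_power qnorm_zeta)
  ultimately have "sys {slope_line b, slope_line (- s *\<^sub>R b)} \<longleftrightarrow>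
      (z ^ e = 1 \<or> z ^ e = -1 \<and> s = 1) \<and> (h = 1 \<or> h = -1 \<and> s = 1)"
    using b s swap j
    by (simp only: sys_slopes_iff image_mult_right_homothetic_iff qnorm_zeta simp_thms)
  also have "\<dots> \<longleftrightarrow> (if s = 1 then m dvd e \<and> (l = 1 \<or> l = 2) else 2 * m dvd e \<and> l = 1)"
    using m l zeta_power_eq_pm1_iff[of m e] zeta_eq_pm1_iff[of l] zeta_eq_1_iff[of l]
      zeta_power_eq_1_iff[of "2 * m" e] by auto
  finally show ?thesis .
qed

section \<open>Criteria for the individual families of candidates\<close>

lemma sys_one_iff:
  "sys (line_pair (vector [1, 1]) (vector [1, -1])) \<longleftrightarrow> m dvd r - 1 \<and> (l = 1 \<or> l = 2)"
proof -
  have "inverse ` {1, - 1 *\<^sub>R 1} = {1, - 1 *\<^sub>R (1 :: quat)}"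
    by simp
  moreover have "(\<lambda>d. qj * d * qj) ` {1, - 1 *\<^sub>R 1} = {1, - 1 *\<^sub>R 1}"
    by (simp add: quat_units insert_commute)
  ultimately show ?thesis
    using sys_homothetic_iff[of 1 1 "r - 1", OF _ _ _ _ z_conj(1)] by (simp add: line_pair_def)
qed

text \<open>The line through \<open>(b, 1)\<close> has slope
  \<open>inverse b = - s *\<^sub>R b\<close> with \<open>s = 1 / (qnorm b)\<^sup>2\<close>, so
  \<open>s = 1\<close> means norm 1. A change of sign by \<open>qj\<close> exchanges the two slopes
  only in that case.\<close>

lemma sys_pure_iff:
  assumes b: "b \<noteq> 0" "re b = 0" and j: "qj * b * qj = b \<or> qj * b * qj = - b \<and> qnorm b = 1"
    and z: "inverse z * b * z ^ r = b * z ^ e"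
  shows "sys (line_pair (vector [1, b]) (vector [b, 1])) \<longleftrightarrow>
    (if qnorm b = 1 then m dvd e \<and> (l = 1 \<or> l = 2) else 2 * m dvd e \<and> l = 1)"
proof -
  define s where "s = 1 / (qnorm b)\<^sup>2"
  have "qnorm b > 0"
    using b(1) qnorm_square_eq_0[of b] by (auto simp: qnorm_def order_less_le)
  then have s: "s > 0" "s = 1 \<longleftrightarrow> qnorm b = 1"
    by (auto simp: s_def power2_eq_1_iff)
  have inv: "inverse b = - s *\<^sub>R b"
    unfolding s_def by (rule inverse_pure[OF b(2)])
  then have "inverse (- s *\<^sub>R b) = b"
    using b(1) by (metis nonzero_inverse_inverse_eq)
  with inv have "inverse ` {b, - s *\<^sub>R b} = {b, - s *\<^sub>R b}"
    by auto
  moreover have "(\<lambda>d. qj * d * qj) ` {b, - s *\<^sub>R b} = {b, - s *\<^sub>R b}"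
    using j s by auto
  moreover have "line_pair (vector [1, b]) (vector [b, 1]) = {slope_line b, slope_line (- s *\<^sub>R b)}"
    using left_line_eq_slope_line[OF b(1), of 1] inv by (simp add: line_pair_def)
  ultimately show ?thesis
    using sys_homothetic_iff[OF b(1) s(1) _ _ z] s(2) by simp
qed

lemma sys_i_iff:
  assumes "a \<noteq> 0"
  shows "sys (line_pair (vector [1, a *\<^sub>R qi]) (vector [a *\<^sub>R qi, 1])) \<longleftrightarrow>
    (if \<bar>a\<bar> = 1 then m dvd r - 1 \<and> (l = 1 \<or> l = 2) else 2 * m dvd r - 1 \<and> l = 1)"
proof -
  have "a *\<^sub>R qi \<noteq> 0" "re (a *\<^sub>R qi) = 0" "qnorm (a *\<^sub>R qi) = \<bar>a\<bar>" "qj * (a *\<^sub>R qi) * qj = a *\<^sub>R qi"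
    using assms unfolding qnorm_scaleR
    by (simp_all add: quat_eq_iff quat_ops_def) (simp add: qnorm_def)
  then show ?thesis
    using sys_pure_iff[OF _ _ _ z_conj(2)] by simp
qed

lemma sys_j_iff:
  "sys (line_pair (vector [1, qj]) (vector [qj, 1])) \<longleftrightarrow> m dvd r + 1 \<and> (l = 1 \<or> l = 2)"
proof -
  have "qj \<noteq> 0" "qj * qj * qj = - qj"
    by (simp_all add: quat_eq_iff quat_ops_def)
  then show ?thesis
    using sys_pure_iff[OF _ _ _ z_conj(3)] by simp
qed

lemma sys_k_iff:
  assumes "c \<noteq> 0"
  shows "sys (line_pair (vector [1, c *\<^sub>R qk]) (vector [c *\<^sub>R qk, 1])) \<longleftrightarrow>
    (if \<bar>c\<bar> = 1 then m dvd r + 1 \<and> (l = 1 \<or> l = 2) else 2 * m dvd r + 1 \<and> l = 1)"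
proof -
  have "c *\<^sub>R qk \<noteq> 0" "re (c *\<^sub>R qk) = 0" "qnorm (c *\<^sub>R qk) = \<bar>c\<bar>" "qj * (c *\<^sub>R qk) * qj = c *\<^sub>R qk"
    using assms unfolding qnorm_scaleR
    by (simp_all add: quat_eq_iff quat_ops_def) (simp add: qnorm_def)
  then show ?thesis
    using sys_pure_iff[OF _ _ _ z_conj(4)] by simp
qed

lemma sys_axes: "sys (line_pair (vector [1, 0]) (vector [0, 1]))"
  by (rule imprimitivity_system_axes[OF pairs_subset])

text \<open>Inversion either fixes both slopes, which makes them 1 and -1, or exchanges them. In the
  latter case \<open>qj * b * qj\<close> is \<open>b\<close> or \<open>inverse b\<close>, which
  leads to the other two alternatives.\<close>

lemma invariant_slopes_cases:
  assumes b: "b \<noteq> 0" "b' \<noteq> 0" "b \<noteq> b'" and sys: "sys {slope_line b, slope_line b'}"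
  obtains (real) "b \<in> {1, -1}" "b' = - b"
  | (j) "b \<in> {qj, - qj}" "b' = inverse b"
  | (ik) "re b = 0" "im2 b = 0" "b' = inverse b" "im1 b \<noteq> 0 \<Longrightarrow> im3 b \<noteq> 0 \<Longrightarrow> m = 1"
proof -
  have stab: "(\<lambda>d. inverse z * d * z ^ r) ` {b, b'} = {b, b'}" "(\<lambda>d. qj * d * qj) ` {b, b'} = {b, b'}"
    "inverse ` {b, b'} = {b, b'}"
    using sys unfolding sys_slopes_iff[OF b] by auto
  show ?thesis
  proof (cases "inverse b = b")
    case True
    then have "b * b = 1"
      using b(1) by (metis right_inverse)
    then have "b = 1 \<or> b = -1"
      by (simp add: square_eq_1_iff)
    \<comment> \<open>Inversion permutes the pair and fixes \<open>b\<close>, so it has to fix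
      \<open>b'\<close> too.\<close>
    moreover have "inverse b' \<noteq> b"
      using True b by (metis nonzero_inverse_inverse_eq)
    then have "inverse b' = b'"
      using stab(3) by auto
    then have "b' * b' = 1"
      using b(2) by (metis right_inverse)
    then have "b' = 1 \<or> b' = -1"
      by (simp add: square_eq_1_iff)
    ultimately show ?thesis
      using b(3) by (intro real) auto
  next
    case False
    then have b': "b' = inverse b"
      using stab(3) by auto
    consider "qj * b * qj = b" | "qj * b * qj = inverse b"
      using stab(2) b' by auto
    then show ?thesis
    proof cases
      case 1
      then have pure: "re b = 0" "im2 b = 0"
        by (simp_all add: quat_eq_iff times_quat_def)
      then have b_eq: "b = im1 b *\<^sub>R qi + im3 b *\<^sub>R qk"
        by (simp add: quat_eq_iff quat_ops_def)
      have "m = 1" if "im1 b \<noteq> 0" "im3 b \<noteq> 0"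
      proof -
        \<comment> \<open>Both \<open>b\<close> and \<open>inverse b\<close> are non-zero real
          multiples of the pure quaternion \<open>b\<close>.\<close>
        obtain t where t: "t \<noteq> 0" "inverse z * b * z ^ r = t *\<^sub>R b"
        proof (cases "inverse z * b * z ^ r = b")
          case True
          then show ?thesis
            using that[of 1] by simp
        next
          case False
          then have "inverse z * b * z ^ r = - (1 / (qnorm b)\<^sup>2) *\<^sub>R b"
            using stab(1) b' inverse_pure[OF pure(1)] by auto
          then show ?thesis
            using that[of "- (1 / (qnorm b)\<^sup>2)"] b(1) qnorm_square_eq_0[of b] by simp
        qed
        have "inverse z * b * z ^ r
            = inverse z * (im1 b *\<^sub>R qi) * z ^ r + inverse z * (im3 b *\<^sub>R qk) * z ^ r"
          by (subst b_eq) (simp add: distrib_left distrib_right)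
        then have *: "im1 b *\<^sub>R qi * z ^ (r - 1) + im3 b *\<^sub>R qk * z ^ (r + 1) = t *\<^sub>R b"
          using t(2) unfolding z_conj by simp
        \<comment> \<open>The first summand lies in the span of \<open>1\<close> and
          \<open>i\<close>, the second in that of \<open>j\<close> and \<open>k\<close>, so they can
          be compared separately with the parts of \<open>t *\<^sub>R b\<close>.\<close>
        have "z ^ (r - 1) = t *\<^sub>R 1 \<and> z ^ (r + 1) = t *\<^sub>R 1"
          using * that pure by (simp add: zeta_power quat_eq_iff quat_ops_def)
        moreover have "z ^ (r + 1) = z ^ (r - 1) * z ^ 2"
          using r by (simp flip: power_add)
        ultimately have "z ^ 2 = 1"
          using t(1) by (metis mult_scaleR_left mult_1 scaleR_left_imp_eq)
        then show ?thesis
          using m by (simp add: zeta_power_eq_1_iff)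
      qed
      then show ?thesis
        using pure b' by (intro ik)
    next
      case 2
      \<comment> \<open>Norms are taken in \<open>qj * b * qj * b = 1\<close>.\<close>
      then have "qnorm b * qnorm b = 1"
        using b(1) by (metis mult.assoc mult_1 mult_1_right qj_simps(1) qnorm_1 qnorm_mult right_inverse)
      then have norm: "qnorm b = 1"
        by (simp add: square_eq_1_iff qnorm_def)
      with 2 have "re b = 0" "im1 b = 0" "im3 b = 0"
        by (simp_all add: inverse_unit_quat quat_eq_iff times_quat_def qcnj_def)
      moreover from this have "\<bar>im2 b\<bar> = 1"
        using norm by (simp add: qnorm_def)
      ultimately have "b = qj \<or> b = - qj"
        by (auto simp: quat_eq_iff quat_ops_def abs_if split: if_splits)
      then show ?thesis
        using b' by (intro j) auto
    qed
  qed
qed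

text \<open>Right multiplication by \<open>h\<close> permutes two slopes, so its square is trivial
  on them and \<open>h * h = 1\<close>.\<close>

lemma slopes_l_le_2:
  assumes b: "b \<noteq> 0" "b' \<noteq> 0" "b \<noteq> b'" and sys: "sys {slope_line b, slope_line b'}"
  shows "l = 1 \<or> l = 2"
proof -
  have "(\<lambda>d. d * h) ` {b, b'} = {b, b'}"
    using sys unfolding sys_slopes_iff[OF b] by auto
  then have "b * h = b \<or> b * h = b' \<and> (b' * h = b \<or> b' * h = b')"
    by auto
  then have "b * h = b * 1 \<or> b * (h * h) = b * 1 \<or> b' * h = b' * 1"
    by (auto simp: mult.assoc)
  then have "h = 1 \<or> h * h = 1"
    using b by (metis mult_left_cancel)
  then show ?thesis
    using zeta_eq_pm1_iff[of l] l by (auto simp: square_eq_1_iff)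
qed

text \<open>The form factors as \<open>v $ 1 * (1 + b' * qcnj b) * qcnj (u $ 1)\<close>.\<close>

lemma hform_slopes:
  assumes "left_line u = slope_line b" "left_line v = slope_line b'" "b' * qcnj b = -1"
  shows "hform v u = 0"
proof -
  have "u $ 2 = u $ 1 * b" "v $ 2 = v $ 1 * b'"
    using assms self_mem_left_line mem_slope_line_iff by blast+
  then have "hform v u = v $ 1 * (1 + b' * qcnj b) * qcnj (u $ 1)"
    by (simp add: hform_def qcnj_mult algebra_simps)
  then show ?thesis
    using assms(3) by simp
qed

lemma inverse_mult_qcnj_pure: "b \<noteq> 0 \<Longrightarrow> re b = 0 \<Longrightarrow> inverse b * qcnj b = -1"
proof -
  assume "b \<noteq> 0" "re b = 0"
  then have "qcnj b = - b"
    by (simp add: qcnj_def quat_eq_iff uminus_quat_def)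
  then show ?thesis
    using \<open>b \<noteq> 0\<close> by simp
qed

lemma imprimitivity_system_classification:
  assumes sys: "sys (line_pair u v)"
    and nontrivial: "line_pair u v \<noteq> line_pair (vector [1, 0]) (vector [0, 1])"
  shows "hform v u = 0" "l = 1 \<or> l = 2"
    "\<exists>b. (left_line u = left_line (vector [1, b]) \<or> left_line v = left_line (vector [1, b])) \<and>
       (b = 1 \<or> (\<exists>a. a \<noteq> 0 \<and> b = a *\<^sub>R qi) \<or> b = qj \<or> (\<exists>c. c \<noteq> 0 \<and> b = c *\<^sub>R qk) \<or>
        (m = 1 \<and> (\<exists>a c. a \<noteq> 0 \<and> c \<noteq> 0 \<and> b = a *\<^sub>R qi + c *\<^sub>R qk)))"
proof -
  obtain b b' where uv: "left_line u = slope_line b" "left_line v = slope_line b'"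
    and b: "b \<noteq> 0" "b' \<noteq> 0" "b \<noteq> b'"
    using imprimitivity_system_slopesE[OF sys pairs_1[OF H.one_closed, simplified] nontrivial] .
  have bb': "sys {slope_line b, slope_line b'}"
    using sys uv by (simp add: line_pair_def)
  then show "l = 1 \<or> l = 2"
    by (rule slopes_l_le_2[OF b])
  from b bb' have "b' * qcnj b = -1 \<and> (\<exists>d\<in>{b, b'}. d = 1 \<or> (\<exists>a. a \<noteq> 0 \<and> d = a *\<^sub>R qi) \<or> d = qj \<or>
      (\<exists>c. c \<noteq> 0 \<and> d = c *\<^sub>R qk) \<or> (m = 1 \<and> (\<exists>a c. a \<noteq> 0 \<and> c \<noteq> 0 \<and> d = a *\<^sub>R qi + c *\<^sub>R qk)))"
  proof (cases rule: invariant_slopes_cases)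
    case real
    then have "b' * qcnj b = -1"
      by (auto simp: quat_eq_iff quat_ops_def qcnj_def)
    then show ?thesis
      using real by auto
  next
    case j
    \<comment> \<open>If \<open>b = - qj\<close>, the representative \<open>qj\<close> is the other
      slope.\<close>
    have "inverse (- qj) = qj"
      using inverse_qj by (metis inverse_minus_eq minus_minus)
    then have "qj \<in> {b, b'}"
      using j by auto
    moreover have "re b = 0"
      using j(1) by (auto simp: uminus_quat_def)
    ultimately show ?thesis
      using inverse_mult_qcnj_pure[OF b(1)] j(2) by auto
  next
    case ik
    have b_eq: "b = im1 b *\<^sub>R qi + im3 b *\<^sub>R qk"
      using ik(1,2) by (simp add: quat_eq_iff quat_ops_def)
    have "(\<exists>a. a \<noteq> 0 \<and> b = a *\<^sub>R qi) \<or> (\<exists>c. c \<noteq> 0 \<and> b = c *\<^sub>R qk) \<or>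
        (m = 1 \<and> (\<exists>a c. a \<noteq> 0 \<and> c \<noteq> 0 \<and> b = a *\<^sub>R qi + c *\<^sub>R qk))"
      using ik(4) b_eq b(1) by (metis add.left_neutral add.right_neutral scaleR_zero_left)
    then show ?thesis
      using inverse_mult_qcnj_pure[OF b(1) ik(1)] ik(3) by auto
  qed
  then show "hform v u = 0"
    "\<exists>b. (left_line u = left_line (vector [1, b]) \<or> left_line v = left_line (vector [1, b])) \<and>
       (b = 1 \<or> (\<exists>a. a \<noteq> 0 \<and> b = a *\<^sub>R qi) \<or> b = qj \<or> (\<exists>c. c \<noteq> 0 \<and> b = c *\<^sub>R qk) \<or>
        (m = 1 \<and> (\<exists>a c. a \<noteq> 0 \<and> c \<noteq> 0 \<and> b = a *\<^sub>R qi + c *\<^sub>R qk)))"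
    using hform_slopes[OF uv] uv by auto
qed

end

section \<open>Admissible integers\<close>

lemma admissible_ge_1: "admissible n r \<Longrightarrow> 1 \<le> r"
  by (auto simp: admissible_def)

text \<open>An admissible \<open>r\<close> other than 1 satisfies
  \<open>0 < r - 1 < m\<close>.\<close>

lemma admissible_dvd_diff_iff:
  assumes "admissible n r" "n \<le> 2 * m"
  shows "m dvd r - 1 \<longleftrightarrow> r = 1"
proof
  assume dvd: "m dvd r - 1"
  show "r = 1"
  proof (rule ccontr)
    assume "r \<noteq> 1"
    then have "1 < r" "2 * r \<le> n"
      using assms(1) by (auto simp: admissible_def)
    then show False
      using dvd_imp_le[OF dvd] assms(2) by linarith
  qed
qed simp

text \<open>If \<open>4\<close> divided \<open>m\<close>, then \<open>\<kappa> = 2\<close> and \<open>\<nu>\<close> would be even, since \<open>r - 1 = m - 2\<close> is not divisible by \<open>4\<close>.\<close>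

lemma admissible_dvd_add_iff:
  assumes adm: "admissible (2 * m) r" and m: "1 \<le> m"
  shows "m dvd r + 1 \<longleftrightarrow> m mod 4 = 2 \<and> r = m - 1 \<or> m = 1 \<and> r = 1"
proof
  assume dvd: "m dvd r + 1"
  show "m mod 4 = 2 \<and> r = m - 1 \<or> m = 1 \<and> r = 1"
  proof (cases "r = 1")
    case True
    then show ?thesis
      using dvd dvd_2_iff[of m] by (auto simp: numeral_2_eq_2)
  next
    case False
    then have r: "1 < r" "r \<le> m" "gcd r (2 * m) = 1"
      and \<kappa>\<nu>: "gcd (2 * m div gcd (2 * m) (r + 1)) (2 * m div gcd (2 * m) (r - 1)) = 1"
      using adm by (auto simp: admissible_def)
    obtain k where k: "r + 1 = m * k"
      using dvd by auto
    \<comment> \<open>Otherwise \<open>2 * m \<le> r + 1 \<le> m + 1\<close>, against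
      \<open>1 < r \<le> m\<close>.\<close>
    have "k < 2"
    proof (rule ccontr)
      assume "\<not> k < 2"
      then have "m * 2 \<le> r + 1"
        unfolding k by (intro mult_le_mono) auto
      then show False
        using r by linarith
    qed
    then have r_eq: "r + 1 = m"
      using k by (cases k) auto
    have "odd r"
    proof
      assume "even r"
      then have "2 dvd gcd r (2 * m)"
        by (intro gcd_greatest) auto
      then show False
        using r by simp
    qed
    then have even: "even m"
      using r_eq by presburger
    have "m mod 4 \<noteq> 0"
    proof
      assume mod: "m mod 4 = 0"
      define g where "g = gcd (2 * m) (r - 1)"
      define \<nu> where "\<nu> = 2 * m div g"
      have "2 * m div gcd (2 * m) (r + 1) = 2"
        unfolding r_eq using m by (simp add: gcd_nat.absorb2)
      then have "coprime 2 \<nu>"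
        using \<kappa>\<nu> by (simp add: coprime_iff_gcd_eq_1 g_def \<nu>_def)
      then have "coprime (2 ^ 3) \<nu>"
        by (rule coprime_power_left_iff[THEN iffD2, OF disjI1])
      \<comment> \<open>As \<open>\<nu>\<close> is odd, the factor 8 of \<open>2 * m\<close> must
        divide \<open>g\<close> and hence \<open>r - 1 = m - 2\<close>, which is 2 modulo 4.\<close>
      moreover have "\<nu> * g = 2 * m"
        unfolding \<nu>_def g_def by simp
      then have "2 ^ 3 dvd \<nu> * g"
        using mod by (simp add: mod_eq_0_iff_dvd)
      ultimately have "2 ^ 3 dvd g"
        by (simp add: coprime_dvd_mult_right_iff)
      then have "2 ^ 3 dvd r - 1"
        unfolding g_def by (rule dvd_trans) simp
      then show False
        using mod r_eq r(1) by simp presburger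
    qed
    then show ?thesis
      using even r_eq by presburger
  qed
next
  assume "m mod 4 = 2 \<and> r = m - 1 \<or> m = 1 \<and> r = 1"
  then show "m dvd r + 1"
    using m by auto
qed

text \<open>This serves \<open>l = 2\<close>, where \<open>n = m\<close>. For \<open>r > 1\<close>
  the bounds \<open>2 * r \<le> m\<close> and \<open>m \<le> r + 1\<close> contradict each
  other.\<close>

lemma admissible_dvd_add_iff':
  assumes adm: "admissible m r" and m: "1 \<le> m"
  shows "m dvd r + 1 \<longleftrightarrow> m \<in> {1, 2} \<and> r = 1"
proof
  assume dvd: "m dvd r + 1"
  have "r = 1"
  proof (rule ccontr)
    assume "r \<noteq> 1"
    then have "1 < r" "2 * r \<le> m"
      using adm by (auto simp: admissible_def)
    then show False
      using dvd_imp_le[OF dvd] by linarith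
  qed
  then show "m \<in> {1, 2} \<and> r = 1"
    using dvd dvd_2_iff[of m] by (simp add: numeral_2_eq_2)
next
  assume "m \<in> {1, 2} \<and> r = 1"
  then show "m dvd r + 1"
    by auto
qed

text \<open>This serves slopes \<open>c k\<close> with \<open>\<bar>c\<bar> \<noteq> 1\<close>, on
  which \<open>z\<close> may not act as a sign.\<close>

lemma admissible_double_dvd_add_iff:
  assumes adm: "admissible (2 * m) r" and m: "1 \<le> m"
  shows "2 * m dvd r + 1 \<longleftrightarrow> m = 1"
proof -
  have r: "r = 1 \<or> r \<le> m"
    using adm by (auto simp: admissible_def)
  show ?thesis
  proof
    assume "2 * m dvd r + 1"
    then have "2 * m \<le> r + 1"
      by (rule dvd_imp_le) simp
    then show "m = 1"
      using r m by linarith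
  next
    assume "m = 1"
    then show "2 * m dvd r + 1"
      using r admissible_ge_1[OF adm] by auto
  qed
qed

text \<open>For \<open>m = 1\<close> the element \<open>zeta 2 = -1\<close> is central and cannot
  separate the \<open>i\<close> and \<open>k\<close> parts of a slope, so the mixed slopes
  \<open>a i + c k\<close> form an alternative of their own.\<close>

theorem theorem6p4:
  fixes m l n r :: nat
    and \<psi> :: "quat set \<Rightarrow> quat set"
    and G :: "(quat ^ 2 ^ 2) set"
  assumes "1 \<le> m" and "1 \<le> l" and "l dvd 2 * m" and "n = 2 * m div l"
    and "admissible n r"
    and "is_psi m l r \<psi>"
    and "G = G_group (Dgrp m) (Cgrp l) \<psi>"
  shows
    "(\<forall>u v. imprimitivity_system G (line_pair u v) \<and>
        line_pair u v \<noteq> line_pair (vector [1, 0]) (vector [0, 1]) \<longrightarrow>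
          hform v u = 0 \<and> l \<in> {1, 2} \<and>
          (\<exists>b. (left_line u = left_line (vector [1, b]) \<or> left_line v = left_line (vector [1, b])) \<and>
               (b = 1 \<or>
                (\<exists>a. a \<noteq> 0 \<and> b = a *\<^sub>R qi) \<or>
                b = qj \<or>
                (\<exists>c. c \<noteq> 0 \<and> b = c *\<^sub>R qk) \<or>
                (m = 1 \<and> (\<exists>a c. a \<noteq> 0 \<and> c \<noteq> 0 \<and> b = a *\<^sub>R qi + c *\<^sub>R qk)))))
     \<and>
     (l \<in> {1, 2} \<longrightarrow>
        (imprimitivity_system G (line_pair (vector [1, 1]) (vector [1, -1])) \<longleftrightarrow> r = 1))
     \<and>
     ((\<exists>a. a \<noteq> 0 \<and>
         imprimitivity_system G (line_pair (vector [1, a *\<^sub>R qi]) (vector [a *\<^sub>R qi, 1])))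
        \<longrightarrow> r = 1)
     \<and>
     (\<forall>a. r = 1 \<longrightarrow>
        (l = 1 \<longrightarrow>
           imprimitivity_system G (line_pair (vector [1, a *\<^sub>R qi]) (vector [a *\<^sub>R qi, 1]))) \<and>
        (l = 2 \<longrightarrow>
           (imprimitivity_system G (line_pair (vector [1, a *\<^sub>R qi]) (vector [a *\<^sub>R qi, 1]))
              \<longleftrightarrow> a \<in> {-1, 0, 1})))
     \<and>
     (l = 1 \<longrightarrow>
        (imprimitivity_system G (line_pair (vector [1, qj]) (vector [qj, 1]))
           \<longleftrightarrow> (m mod 4 = 2 \<and> r = m - 1) \<or> (m = 1 \<and> r = 1)))
     \<and>
     (l = 2 \<longrightarrow>
        (imprimitivity_system G (line_pair (vector [1, qj]) (vector [qj, 1]))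
           \<longleftrightarrow> m \<in> {1, 2} \<and> r = 1))
     \<and>
     ((\<forall>c. imprimitivity_system G (line_pair (vector [1, c *\<^sub>R qk]) (vector [c *\<^sub>R qk, 1])))
        \<longleftrightarrow> m = 1 \<and> l = 1)
     \<and>
     (l = 1 \<and> 2 \<le> m \<longrightarrow>
        (imprimitivity_system G (line_pair (vector [1, qk]) (vector [qk, 1]))
           \<longleftrightarrow> m mod 4 = 2 \<and> r = m - 1))
     \<and>
     (l = 2 \<longrightarrow>
        (imprimitivity_system G (line_pair (vector [1, qk]) (vector [qk, 1]))
           \<longleftrightarrow> m \<in> {1, 2} \<and> r = 1))"
proof -
  interpret standard_copy m l r \<psi>
    using assms admissible_ge_1 by unfold_locales auto
  have G: "G = monomial_group pairs"
    unfolding assms(7) pairs_def by (rule G_group_eq_monomial_group)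
  have "n \<le> 2 * m"
    using assms(4) by simp
  then have minus: "m dvd r - 1 \<longleftrightarrow> r = 1"
    using assms(5) by (rule admissible_dvd_diff_iff[rotated])
  have l1: "admissible (2 * m) r" if "l = 1"
    using assms(4,5) that by simp
  have l2: "admissible m r" if "l = 2"
    using assms(4,5) that by simp
  note plus1 = admissible_dvd_add_iff[OF l1 m] and plus2 = admissible_dvd_add_iff'[OF l2 m]
  have k1: "sys (line_pair (vector [1, qk]) (vector [qk, 1])) \<longleftrightarrow> m dvd r + 1 \<and> (l = 1 \<or> l = 2)"
    using sys_k_iff[of 1] by simp
  have all_k: "(\<forall>c. sys (line_pair (vector [1, c *\<^sub>R qk]) (vector [c *\<^sub>R qk, 1]))) \<longleftrightarrow> m = 1 \<and> l = 1"
  proof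
    assume "\<forall>c. sys (line_pair (vector [1, c *\<^sub>R qk]) (vector [c *\<^sub>R qk, 1]))"
    then show "m = 1 \<and> l = 1"
      \<comment> \<open>The value 2 avoids 0 and absolute value 1, so the stricter condition
        applies.\<close>
      using sys_k_iff[of 2] admissible_double_dvd_add_iff[OF l1 m] by simp
  next
    assume ml: "m = 1 \<and> l = 1"
    then have "2 * m dvd r + 1"
      using admissible_double_dvd_add_iff[OF l1 m] by simp
    then show "\<forall>c. sys (line_pair (vector [1, c *\<^sub>R qk]) (vector [c *\<^sub>R qk, 1]))"
      using sys_k_iff sys_axes ml by (metis dvd_mult_right one_dvd scaleR_zero_left)
  qed
  \<comment> \<open>Both branches of the criterion yield \<open>m dvd r - 1\<close>.\<close>
  have i_r: "r = 1" if "a \<noteq> 0" "sys (line_pair (vector [1, a *\<^sub>R qi]) (vector [a *\<^sub>R qi, 1]))" for a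
    using that sys_i_iff[of a] minus dvd_mult_right[of 2 m "r - 1"] by (auto split: if_splits)
  have i: "sys (line_pair (vector [1, a *\<^sub>R qi]) (vector [a *\<^sub>R qi, 1])) \<longleftrightarrow>
      l = 1 \<or> l = 2 \<and> a \<in> {-1, 0, 1}" if "r = 1" "l = 1 \<or> l = 2" for a
  proof (cases "a = 0")
    case True
    then show ?thesis
      using sys_axes that by auto
  next
    case False
    then show ?thesis
      using sys_i_iff[of a] that by (auto simp: abs_if split: if_splits)
  qed
  show ?thesis
    unfolding G
  proof (intro conjI)
    show "\<forall>u v. sys (line_pair u v) \<and> line_pair u v \<noteq> line_pair (vector [1, 0]) (vector [0, 1]) \<longrightarrow>
        hform v u = 0 \<and> l \<in> {1, 2} \<and>
        (\<exists>b. (left_line u = left_line (vector [1, b]) \<or> left_line v = left_line (vector [1, b])) \<and>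
          (b = 1 \<or> (\<exists>a. a \<noteq> 0 \<and> b = a *\<^sub>R qi) \<or> b = qj \<or> (\<exists>c. c \<noteq> 0 \<and> b = c *\<^sub>R qk) \<or>
           (m = 1 \<and> (\<exists>a c. a \<noteq> 0 \<and> c \<noteq> 0 \<and> b = a *\<^sub>R qi + c *\<^sub>R qk))))"
    proof (intro allI impI, elim conjE)
      fix u v
      assume "sys (line_pair u v)" "line_pair u v \<noteq> line_pair (vector [1, 0]) (vector [0, 1])"
      note c = imprimitivity_system_classification[OF this]
      from c(2) have "l \<in> {1, 2}"
        by simp
      with c(1,3) show "hform v u = 0 \<and> l \<in> {1, 2} \<and>
        (\<exists>b. (left_line u = left_line (vector [1, b]) \<or> left_line v = left_line (vector [1, b])) \<and>
          (b = 1 \<or> (\<exists>a. a \<noteq> 0 \<and> b = a *\<^sub>R qi) \<or> b = qj \<or> (\<exists>c. c \<noteq> 0 \<and> b = c *\<^sub>R qk) \<or>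
           (m = 1 \<and> (\<exists>a c. a \<noteq> 0 \<and> c \<noteq> 0 \<and> b = a *\<^sub>R qi + c *\<^sub>R qk))))"
        by iprover
    qed
  qed (use sys_one_iff minus i_r i sys_j_iff k1 all_k plus1 plus2 in auto)
qed

end
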